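(* Let $X$ be a random variable supported on $[0,1]$ with $\mathrm{Var}(X)=\sigma^2>0$. There exists $\epsilon_0(\sigma)>0$, depending only on $\sigma$, such that for all $0<\epsilon<\epsilon_0(\sigma)$ the following holds: letting $G$ be the distribution of $1+\epsilon X$, the limit shape corresponding to $G$ satisfies $$\mathrm{Sides}(\mathcal B_G)\ge\frac{\log(1/\epsilon)}{\log\log(1/\epsilon)}.$$
   Context: First-passage percolation on the nearest-neighbour lattice $(\mathbb Z^2,E(\mathbb Z^2))$: $G$ is a probability measure on $[0,\infty)$ and $(t_e)_{e\in E(\mathbb Z^2)}$ are i.i.d. with law $G$. A finite path $p$ has passage time $T(p)=\sum_{e\in p}t_e$, and $T(u,v)=\inf_p T(p)$ over all paths connecting $u,v\in\mathbb Z^2$. Limit shape: let $B(t)=\{v\in\mathbb Z^2:T(0,v)\le t\}+[-\tfrac12,\tfrac12]^2$. $\mathcal B_G$ is the deterministic (closed) convex set such that for all $\epsilon>0$, almost surely $(1-\epsilon)\mathcal B_G\subseteq B(t)/t\subseteq(1+\epsilon)\mathcal B_G$ for all sufficiently large $t$ (it exists by the Cox–Durrett theorem, in particular for bounded weights bounded away from $0$). $\mathrm{Sides}(\mathcal B_G)$ is the number of edges of $\mathcal B_G$ if it is a polygon and $+\infty$ otherwise (equivalently, the number of extreme points of $\mathcal B_G$). *)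

theory Defs
  imports "HOL-Probability.Probability" "HOL-Library.Set_Algebras"
begin

definition lattice_adj :: "int \<times> int \<Rightarrow> int \<times> int \<Rightarrow> bool" where
  "lattice_adj u v \<longleftrightarrow> \<bar>fst u - fst v\<bar> + \<bar>snd u - snd v\<bar> = 1"

definition lattice_edges :: "(int \<times> int) set set" where
  "lattice_edges = {{u, v} | u v. lattice_adj u v}"

definition lattice_path :: "int \<times> int \<Rightarrow> int \<times> int \<Rightarrow> (int \<times> int) list \<Rightarrow> bool" where
  "lattice_path u v p \<longleftrightarrow> p \<noteq> [] \<and> hd p = u \<and> last p = v \<and> successively lattice_adj p"

text \<open>Paths are given by their list of vertices and may revisit vertices. For nonnegative
  weights this does not change the infimum in \<open>first_passage_time\<close>.\<close>

definition path_time :: "((int \<times> int) set \<Rightarrow> real) \<Rightarrow> (int \<times> int) list \<Rightarrow> real" where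
  "path_time w p = (\<Sum>i<length p - 1. w {p ! i, p ! Suc i})"

definition first_passage_time ::
    "((int \<times> int) set \<Rightarrow> real) \<Rightarrow> int \<times> int \<Rightarrow> int \<times> int \<Rightarrow> real" where
  "first_passage_time w u v = (INF p\<in>{p. lattice_path u v p}. path_time w p)"

definition fpp_ball :: "((int \<times> int) set \<Rightarrow> real) \<Rightarrow> real \<Rightarrow> (real \<times> real) set" where
  "fpp_ball w t =
     map_prod real_of_int real_of_int ` {v. first_passage_time w (0, 0) v \<le> t}
       + {-1/2..1/2} \<times> {-1/2..1/2}"

text \<open>The i.i.d. weights with law \<open>G\<close> are the coordinates of the product space over the edges.
  The relative error \<open>\<epsilon>\<close> has to stay below 1: for larger \<open>\<epsilon>\<close> the factor \<open>1 - \<epsilon>\<close> would be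
  negative and the left inclusion would fail for every candidate shape.\<close>

definition limit_shape :: "real measure \<Rightarrow> (real \<times> real) set \<Rightarrow> bool" where
  "limit_shape G B \<longleftrightarrow> closed B \<and> convex B \<and>
     (\<forall>\<epsilon>. 0 < \<epsilon> \<and> \<epsilon> < 1 \<longrightarrow>
       (AE w in Pi\<^sub>M lattice_edges (\<lambda>_. G). \<forall>\<^sub>F t in at_top.
          (\<lambda>x. (1 - \<epsilon>) *\<^sub>R x) ` B \<subseteq> (\<lambda>x. x /\<^sub>R t) ` fpp_ball w t \<and>
          (\<lambda>x. x /\<^sub>R t) ` fpp_ball w t \<subseteq> (\<lambda>x. (1 + \<epsilon>) *\<^sub>R x) ` B))"

lemma limit_shapeD:
  assumes "limit_shape G B" "0 < \<epsilon>" "\<epsilon> < 1"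
  shows "AE w in Pi\<^sub>M lattice_edges (\<lambda>_. G). \<forall>\<^sub>F t in at_top.
    (\<lambda>x. (1 - \<epsilon>) *\<^sub>R x) ` B \<subseteq> (\<lambda>x. x /\<^sub>R t) ` fpp_ball w t \<and>
    (\<lambda>x. x /\<^sub>R t) ` fpp_ball w t \<subseteq> (\<lambda>x. (1 + \<epsilon>) *\<^sub>R x) ` B"
  using assms(1)[unfolded limit_shape_def] assms(2,3) by (elim conjE allE impE) (rule conjI)

lemma limit_shape_subset:
  assumes "prob_space G" "limit_shape G B" "limit_shape G B'"
  shows "B \<subseteq> B'"
proof
  fix b assume b: "b \<in> B"
  interpret P: prob_space "Pi\<^sub>M lattice_edges (\<lambda>_. G)"
    by (rule prob_space_PiM) (rule assms(1))
  have *: "((1 - \<epsilon>) / (1 + \<epsilon>)) *\<^sub>R b \<in> B'" if e: "0 < \<epsilon>" "\<epsilon> < 1" for \<epsilon> :: real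
  proof -
    have "AE w in Pi\<^sub>M lattice_edges (\<lambda>_. G). (1 - \<epsilon>) *\<^sub>R b \<in> (\<lambda>x. (1 + \<epsilon>) *\<^sub>R x) ` B'"
    proof -
      have "AE w in Pi\<^sub>M lattice_edges (\<lambda>_. G). \<forall>\<^sub>F t in at_top.
          (\<lambda>x. (1 - \<epsilon>) *\<^sub>R x) ` B \<subseteq> (\<lambda>x. x /\<^sub>R t) ` fpp_ball w t \<and>
          (\<lambda>x. x /\<^sub>R t) ` fpp_ball w t \<subseteq> (\<lambda>x. (1 + \<epsilon>) *\<^sub>R x) ` B"
        by (rule limit_shapeD[OF assms(2) e])
      moreover have "AE w in Pi\<^sub>M lattice_edges (\<lambda>_. G). \<forall>\<^sub>F t in at_top.
          (\<lambda>x. (1 - \<epsilon>) *\<^sub>R x) ` B' \<subseteq> (\<lambda>x. x /\<^sub>R t) ` fpp_ball w t \<and>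
          (\<lambda>x. x /\<^sub>R t) ` fpp_ball w t \<subseteq> (\<lambda>x. (1 + \<epsilon>) *\<^sub>R x) ` B'"
        by (rule limit_shapeD[OF assms(3) e])
      ultimately show ?thesis
      proof eventually_elim
        case (elim w)
        have "\<forall>\<^sub>F t::real in at_top. (1 - \<epsilon>) *\<^sub>R b \<in> (\<lambda>x. (1 + \<epsilon>) *\<^sub>R x) ` B'"
          using elim
        proof eventually_elim
          case (elim t)
          have "(1 - \<epsilon>) *\<^sub>R b \<in> (\<lambda>x. (1 - \<epsilon>) *\<^sub>R x) ` B"
            by (rule imageI) (rule b)
          then show ?case
            using elim by (meson subsetD)
        qed
        then show ?case
          by (simp only: eventually_const trivial_limit_at_top_linorder not_False_eq_True)
      qed
    qed
    then have "(1 - \<epsilon>) *\<^sub>R b \<in> (\<lambda>x. (1 + \<epsilon>) *\<^sub>R x) ` B'"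
      by (simp only: P.AE_const)
    then obtain c where c: "c \<in> B'" "(1 - \<epsilon>) *\<^sub>R b = (1 + \<epsilon>) *\<^sub>R c" by blast
    have "((1 - \<epsilon>) / (1 + \<epsilon>)) *\<^sub>R b = (1 / (1 + \<epsilon>)) *\<^sub>R ((1 - \<epsilon>) *\<^sub>R b)"
      by (simp only: scaleR_scaleR) simp
    also have "\<dots> = (1 / (1 + \<epsilon>) * (1 + \<epsilon>)) *\<^sub>R c" by (simp only: c(2) scaleR_scaleR)
    also have "1 / (1 + \<epsilon>) * (1 + \<epsilon>) = 1" using e by simp
    also have "1 *\<^sub>R c = c" by (rule scaleR_one)
    finally show ?thesis by (simp only: c(1))
  qed
  have "((\<lambda>\<epsilon>::real. ((1 - \<epsilon>) / (1 + \<epsilon>)) *\<^sub>R b) \<longlongrightarrow> ((1 - 0) / (1 + 0)) *\<^sub>R b) (at_right 0)"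
    by (intro tendsto_intros) auto
  moreover have "\<forall>\<^sub>F \<epsilon> in at_right (0::real). ((1 - \<epsilon>) / (1 + \<epsilon>)) *\<^sub>R b \<in> B'"
    unfolding eventually_at_right_field by (rule exI[of _ 1]) (auto intro: *)
  moreover have "closed B'" using assms(3) by (simp add: limit_shape_def)
  ultimately show "b \<in> B'"
    using Lim_in_closed_set[of B' "\<lambda>\<epsilon>::real. ((1 - \<epsilon>) / (1 + \<epsilon>)) *\<^sub>R b" "at_right 0"]
    by simp
qed

lemma limit_shape_unique:
  assumes "prob_space G" "limit_shape G B" "limit_shape G B'"
  shows "B = B'"
  using limit_shape_subset assms by (metis subset_antisym)

definition polygon :: "(real \<times> real) set \<Rightarrow> bool" where
  "polygon B \<longleftrightarrow> polytope B \<and> aff_dim B = 2"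

definition sides :: "(real \<times> real) set \<Rightarrow> enat" where
  "sides B = (if polygon B then enat (card {e. e edge_of B}) else \<infinity>)"

end

theory Submission
  imports Defs "HOL-Real_Asymp.Real_Asymp"
begin

text \<open>Let \<open>\<tau>\<close> be the mean weight and \<open>L = ln (1 / \<epsilon>)\<close>, and compare the limit shape in the
  direction \<open>(1, \<plusminus>1 / W)\<close> with its first-order approximation \<open>(1 + 1 / W) * \<tau>\<close>. Choosing the cheaper of
  two routes in each block of size \<open>W \<times> 1\<close> saves at least \<open>c * \<epsilon> / sqrt W\<close> per unit, with \<open>c\<close> depending
  only on \<open>\<sigma>\<close>. Conversely a union bound over self-avoiding paths, with Hoeffding's inequality, shows
  that no path saves more than \<open>9 * \<epsilon> * sqrt (L / W)\<close>. The saving is affine on the cone over an edge, so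
  an edge cannot meet two rays of slopes \<open>1 / k ^ (2 * i)\<close> and \<open>1 / k ^ (2 * i')\<close> once \<open>k\<close> exceeds a
  constant times \<open>L\<close>: halfway between them (on the logarithmic scale) the affine saving would be too
  small. Neither can an edge meet rays of both signs, because \<open>\<epsilon> * sqrt (L * W)\<close> is small. This
  gives \<open>2 * M\<close> edges with \<open>M\<close> about \<open>3 / 4 * L / ln L\<close>.\<close>

subsection \<open>Lattice paths\<close>

lemma path_time_singleton [simp]: "path_time w [u] = 0"
  by (simp add: path_time_def)

lemma path_time_Cons_Cons [simp]:
  "path_time w (u # v # p) = w {u, v} + path_time w (v # p)"
  by (simp add: path_time_def sum.lessThan_Suc_shift del: sum.lessThan_Suc)

lemma path_time_append: "path_time w (p @ v # q) = path_time w (p @ [v]) + path_time w (v # q)"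
proof (induction p)
  case Nil
  show ?case by simp
next
  case (Cons a p)
  then show ?case by (cases p) auto
qed

lemma path_time_snoc: "p \<noteq> [] \<Longrightarrow> path_time w (p @ [v]) = path_time w p + w {last p, v}"
  by (cases p rule: rev_cases) (simp_all add: path_time_append[of w _ _ "[v]"])

lemma lattice_path_singleton [simp]: "lattice_path u v [x] \<longleftrightarrow> x = u \<and> u = v"
  by (auto simp: lattice_path_def)

lemma lattice_path_Cons_Cons [simp]:
  "lattice_path u v (x # y # p) \<longleftrightarrow> x = u \<and> lattice_adj u y \<and> lattice_path y v (y # p)"
  by (auto simp: lattice_path_def)

lemma lattice_path_snoc_iff:
  "p \<noteq> [] \<Longrightarrow> lattice_path u v (p @ [x]) \<longleftrightarrow> x = v \<and> lattice_path u (last p) p \<and> lattice_adj (last p) v"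
  by (auto simp: lattice_path_def successively_append_iff)

lemma lattice_edgeI: "lattice_adj u v \<Longrightarrow> {u, v} \<in> lattice_edges"
  unfolding lattice_edges_def by blast

lemma lattice_edge_nth:
  assumes "successively lattice_adj p" "Suc i < length p"
  shows "{p ! i, p ! Suc i} \<in> lattice_edges"
  using assms by (intro lattice_edgeI) (simp add: successively_conv_nth)

lemma path_time_ge:
  assumes "lattice_path u v p" "\<And>e. e \<in> lattice_edges \<Longrightarrow> c \<le> w e"
  shows "c * real (length p - 1) \<le> path_time w p"
proof -
  have "(\<Sum>i<length p - 1. c) \<le> path_time w p"
    unfolding path_time_def using assms(1)
    by (intro sum_mono assms(2) lattice_edge_nth) (auto simp: lattice_path_def)
  then show ?thesis by (simp add: mult.commute)
qed

lemma path_time_le: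
  assumes "lattice_path u v p" "\<And>e. e \<in> lattice_edges \<Longrightarrow> w e \<le> c"
  shows "path_time w p \<le> c * real (length p - 1)"
proof -
  have "path_time w p \<le> (\<Sum>i<length p - 1. c)"
    unfolding path_time_def using assms(1)
    by (intro sum_mono assms(2) lattice_edge_nth) (auto simp: lattice_path_def)
  then show ?thesis by (simp add: mult.commute)
qed

lemma path_time_nonneg:
  assumes "lattice_path u v p" "\<And>e. e \<in> lattice_edges \<Longrightarrow> 0 \<le> w e"
  shows "0 \<le> path_time w p"
  using path_time_ge[OF assms(1), of 0 w] assms(2) by simp

lemma first_passage_time_le:
  assumes "lattice_path u v p" "\<And>e. e \<in> lattice_edges \<Longrightarrow> 0 \<le> w e"
  shows "first_passage_time w u v \<le> path_time w p"
  unfolding first_passage_time_def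
  by (intro cINF_lower bdd_belowI2[where m = 0]) (use assms path_time_nonneg in auto)

lemma length_lattice_path_ge:
  assumes "lattice_path u v p"
  shows "\<bar>fst v - fst u\<bar> + \<bar>snd v - snd u\<bar> \<le> int (length p - 1)"
  using assms
proof (induction p arbitrary: u)
  case Nil
  then show ?case by (simp add: lattice_path_def)
next
  case (Cons a p)
  show ?case
  proof (cases p)
    case Nil
    with Cons show ?thesis by simp
  next
    case (Cons b q)
    with Cons.prems Cons.IH[of b] show ?thesis
      by (auto simp: lattice_adj_def)
  qed
qed

text \<open>Stepping back from \<open>v\<close> towards the origin lowers the l1 norm by one each
  time. This supplies both a cheap path to \<open>v\<close> and the nonemptiness needed for lower
  bounds on infima over paths.\<close>

lemma exists_lattice_path:
  "\<exists>p. lattice_path (0, 0) v p \<and> int (length p - 1) = \<bar>fst v\<bar> + \<bar>snd v\<bar>"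
proof (induction "nat (\<bar>fst v\<bar> + \<bar>snd v\<bar>)" arbitrary: v)
  case 0
  then have "lattice_path (0, 0) v [(0, 0)]" by (cases v) auto
  moreover from 0 have "\<bar>fst v\<bar> + \<bar>snd v\<bar> = 0" by simp
  ultimately show ?case by (intro exI[of _ "[(0, 0)]"]) auto
next
  case (Suc n)
  define u where "u = (if fst v \<noteq> 0 then (fst v - sgn (fst v), snd v) else (0, snd v - sgn (snd v)))"
  have u: "\<bar>fst u\<bar> + \<bar>snd u\<bar> = \<bar>fst v\<bar> + \<bar>snd v\<bar> - 1" and adj: "lattice_adj u v"
    using Suc(2) by (auto simp: u_def sgn_if lattice_adj_def)
  obtain p where p: "lattice_path (0, 0) u p" "int (length p - 1) = \<bar>fst u\<bar> + \<bar>snd u\<bar>"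
  proof -
    have "n = nat (\<bar>fst u\<bar> + \<bar>snd u\<bar>)" using Suc(2) u by linarith
    from Suc(1)[OF this] show ?thesis using that by blast
  qed
  then have "p \<noteq> []" "last p = u" by (auto simp: lattice_path_def)
  then have "lattice_path (0, 0) v (p @ [v])" "int (length (p @ [v]) - 1) = \<bar>fst v\<bar> + \<bar>snd v\<bar>"
    using p u adj by (auto simp: lattice_path_snoc_iff of_nat_diff Suc_le_eq)
  then show ?case by blast
qed

text \<open>Loop erasure: if the new first vertex recurs in the tail already made self-avoiding, the
  loop back to it is cut off, and nonnegative weights make the result no dearer. Concentration
  bounds are applied to self-avoiding paths, along which no edge weight is counted twice.\<close>

lemma ex_distinct_lattice_path:
  assumes "lattice_path u v p" "\<And>e. e \<in> lattice_edges \<Longrightarrow> 0 \<le> w e"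
  shows "\<exists>q. lattice_path u v q \<and> distinct q \<and> path_time w q \<le> path_time w p"
  using assms(1)
proof (induction p arbitrary: u)
  case Nil
  then show ?case by (simp add: lattice_path_def)
next
  case (Cons a p)
  show ?case
  proof (cases p)
    case Nil
    with Cons.prems show ?thesis by (intro exI[of _ "[a]"]) auto
  next
    case (Cons b p')
    with Cons.prems have *: "a = u" "lattice_adj u b" "lattice_path b v p" by auto
    obtain q where q: "lattice_path b v q" "distinct q" "path_time w q \<le> path_time w p"
      using Cons.IH[OF *(3)] by blast
    from q(1) obtain q' where q': "q = b # q'" by (cases q) (auto simp: lattice_path_def)
    have edge: "0 \<le> w {u, b}" using assms(2) *(2) by (simp add: lattice_edgeI)
    show ?thesis
    proof (cases "u \<in> set q")
      case False
      then show ?thesis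
        using q q' * Cons by (intro exI[of _ "u # q"]) auto
    next
      case True
      then obtain q1 q2 where split: "q = q1 @ u # q2" by (meson split_list)
      have path: "lattice_path u v (u # q2)"
        using q(1) split by (auto simp: lattice_path_def successively_append_iff)
      \<comment> \<open>The discarded loop, closed up at \<open>u\<close>, is itself a path, so its
        passage time is nonnegative.\<close>
      have "lattice_path b u (q1 @ [u])"
        using q(1) split
        by (cases q1) (auto simp: lattice_path_def successively_append_iff successively_Cons hd_append)
      then have "0 \<le> path_time w (q1 @ [u])" by (rule path_time_nonneg) (rule assms(2))
      then have "path_time w (u # q2) \<le> path_time w q"
        unfolding split path_time_append[of w q1 u q2] by linarith
      also have "\<dots> \<le> path_time w (a # p)"
        using q(3) edge by (simp add: \<open>a = u\<close> Cons)
      finally show ?thesis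
        using path q(2) split by (intro exI[of _ "u # q2"]) simp
    qed
  qed
qed

section \<open>Edge sets of self-avoiding paths\<close>

text \<open>A set rather than a list: on a path with distinct vertices no edge repeats, so the
  passage time becomes a sum of distinct coordinates of the product space.\<close>

definition path_edges :: "(int \<times> int) list \<Rightarrow> (int \<times> int) set set" where
  "path_edges p = (\<lambda>i. {p ! i, p ! Suc i}) ` {..<length p - 1}"

lemma finite_path_edges [simp]: "finite (path_edges p)"
  by (simp add: path_edges_def)

lemma path_edges_subset: "lattice_path u v p \<Longrightarrow> path_edges p \<subseteq> lattice_edges"
  by (auto simp: path_edges_def lattice_path_def intro!: lattice_edge_nth)

lemma inj_on_path_edges:
  assumes "distinct p"
  shows "inj_on (\<lambda>i. {p ! i, p ! Suc i}) {..<length p - 1}"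
  using assms by (auto simp: inj_on_def doubleton_eq_iff nth_eq_iff_index_eq)

lemma card_path_edges: "distinct p \<Longrightarrow> card (path_edges p) = length p - 1"
  using card_image[OF inj_on_path_edges] by (simp add: path_edges_def)

lemma path_time_eq_sum_path_edges:
  "distinct p \<Longrightarrow> path_time w p = (\<Sum>e\<in>path_edges p. w e)"
  unfolding path_edges_def path_time_def by (subst sum.reindex[OF inj_on_path_edges]) simp_all

section \<open>Counting paths with given endpoint and length\<close>

definition paths_of_length :: "int \<times> int \<Rightarrow> nat \<Rightarrow> (int \<times> int) list set" where
  "paths_of_length v l = {p. lattice_path (0, 0) v p \<and> length p = Suc l}"

lemma paths_of_length_Suc:
  "paths_of_length (a, b) (Suc l) = (\<lambda>p. p @ [(a, b)]) `
     (paths_of_length (a - 1, b) l \<union> paths_of_length (a, b - 1) l \<union>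
      paths_of_length (a, b + 1) l \<union> paths_of_length (a + 1, b) l)" (is "?L = ?R")
proof (intro equalityI subsetI)
  fix p assume p: "p \<in> ?L"
  then have "p \<noteq> []" by (auto simp: paths_of_length_def)
  then obtain q x where q: "p = q @ [x]" by (metis append_butlast_last_id)
  with p have "q \<noteq> []" by (auto simp: paths_of_length_def)
  with p q have x: "x = (a, b)" "lattice_path (0, 0) (last q) q" "lattice_adj (last q) (a, b)" "length q = Suc l"
    by (auto simp: paths_of_length_def lattice_path_snoc_iff)
  have "last q \<in> {(a - 1, b), (a, b - 1), (a, b + 1), (a + 1, b)}"
    using x(3) by (cases "last q") (auto simp: lattice_adj_def abs_if split: if_splits)
  with x q show "p \<in> ?R" by (auto simp: paths_of_length_def)
next
  fix p assume "p \<in> ?R"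
  then obtain q v where q: "p = q @ [(a, b)]" "lattice_path (0, 0) v q" "length q = Suc l" "lattice_adj v (a, b)"
    by (auto simp: paths_of_length_def lattice_adj_def)
  then have "q \<noteq> []" "last q = v" by (auto simp: lattice_path_def)
  with q show "p \<in> ?L" by (auto simp: paths_of_length_def lattice_path_snoc_iff)
qed

text \<open>Giving a step weight \<open>z\<close> to the power of its loss in the first coordinate, the four steps
  have total weight \<open>1 + 2 * z + z\<^sup>2\<close>.\<close>

lemma card_paths_of_length:
  assumes "z > 0"
  shows "finite (paths_of_length v l) \<and>
    real (card (paths_of_length v l)) \<le> (1 + z) ^ (2 * l) * z powr (of_int (fst v) - real l)"
proof (induction l arbitrary: v)
  case 0
  have "paths_of_length v 0 \<subseteq> {[v]}"
    by (auto simp: paths_of_length_def length_Suc_conv)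
  moreover have "paths_of_length v 0 = {}" if "v \<noteq> (0, 0)"
    using that by (auto simp: paths_of_length_def length_Suc_conv)
  ultimately show ?case
    using assms by (cases "v = (0, 0)") (auto dest: card_mono[rotated] finite_subset)
next
  case (Suc l)
  obtain a b where v: "v = (a, b)" by fastforce
  let ?P = "\<lambda>a b. paths_of_length (a, b) l"
  let ?Q = "?P (a - 1) b \<union> ?P a (b - 1) \<union> ?P a (b + 1) \<union> ?P (a + 1) b"
  define F where "F = (1 + z) ^ (2 * l) * z powr (of_int a - real (Suc l))"
  have fin: "finite ?Q" using Suc by auto
  have powr_Suc: "z powr (x + 1) = z * z powr x" for x
    using assms by (simp add: powr_add mult.commute)
  \<comment> \<open>Relative to the exponent \<open>a - Suc l\<close> of \<open>F\<close>, a
    predecessor with first coordinate \<open>a - 1\<close>, \<open>a\<close> or \<open>a + 1\<close>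
    contributes the factor 1, \<open>z\<close> or \<open>z ^ 2\<close>. The middle value occurs for
    two predecessors.\<close>
  have powr_eqs: "z powr (of_int a - real l) = z * z powr (of_int a - real (Suc l))"
    "z powr (of_int a + 1 - real l) = z ^ 2 * z powr (of_int a - real (Suc l))"
    "of_int (a - 1) - real l = of_int a - real (Suc l)"
    using powr_Suc[of "of_int a - real (Suc l)"] powr_Suc[of "of_int a - real l"]
    by (simp_all add: power2_eq_square algebra_simps)
  have "card (paths_of_length v (Suc l)) \<le> card ?Q"
    unfolding v paths_of_length_Suc by (rule card_image_le[OF fin])
  also have "\<dots> \<le> card (?P (a - 1) b) + card (?P a (b - 1)) + card (?P a (b + 1)) + card (?P (a + 1) b)"
    by (intro order_trans[OF card_Un_le] add_mono order_refl)
  finally have "real (card (paths_of_length v (Suc l))) \<le> real (card (?P (a - 1) b)) + real (card (?P a (b - 1)))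
     + real (card (?P a (b + 1))) + real (card (?P (a + 1) b))"
    by linarith
  also have "\<dots> \<le> F + z * F + z * F + z ^ 2 * F"
  proof (intro add_mono)
    show "real (card (?P (a - 1) b)) \<le> F"
      using Suc[of "(a - 1, b)"] by (simp add: F_def powr_eqs algebra_simps)
    show "real (card (?P a (b - 1))) \<le> z * F"
      using Suc[of "(a, b - 1)"] by (simp only: fst_conv powr_eqs F_def mult.left_commute)
    show "real (card (?P a (b + 1))) \<le> z * F"
      using Suc[of "(a, b + 1)"] by (simp only: fst_conv powr_eqs F_def mult.left_commute)
    show "real (card (?P (a + 1) b)) \<le> z ^ 2 * F"
      using Suc[of "(a + 1, b)"]
      by (simp only: fst_conv powr_eqs F_def mult.left_commute of_int_add of_int_1)
  qed
  also have "\<dots> = (1 + z) ^ (2 * Suc l) * z powr (of_int a - real (Suc l))"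
    by (simp add: F_def power2_eq_square algebra_simps)
  finally show ?case
    using fin unfolding v paths_of_length_Suc by simp
qed

section \<open>Concatenating routes\<close>

text \<open>Hides the vertex list and keeps only endpoints and passage time, so that routes can be
  extended block by block without handling lists.\<close>

definition route :: "((int \<times> int) set \<Rightarrow> real) \<Rightarrow> int \<times> int \<Rightarrow> int \<times> int \<Rightarrow> real \<Rightarrow> bool" where
  "route w u v x \<longleftrightarrow> (\<exists>p. lattice_path u v p \<and> path_time w p = x)"

lemma route_refl: "route w u u 0"
  unfolding route_def by (rule exI[of _ "[u]"]) simp

lemma route_step:
  assumes "route w u v x" "lattice_adj v v'"
  shows "route w u v' (x + w {v, v'})"
proof -
  from assms obtain p where p: "lattice_path u v p" "path_time w p = x" by (auto simp: route_def)
  then have "p \<noteq> []" "last p = v" by (auto simp: lattice_path_def)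
  then show ?thesis
    using p assms(2) unfolding route_def
    by (intro exI[of _ "p @ [v']"]) (auto simp: lattice_path_snoc_iff path_time_snoc)
qed

lemma route_horizontal:
  assumes "route w u (a, b) x"
  shows "route w u (a + int n, b) (x + (\<Sum>c<n. w {(a + int c, b), (a + int c + 1, b)}))"
proof (induction n)
  case 0
  then show ?case using assms by simp
next
  case (Suc n)
  from route_step[OF Suc, of "(a + int n + 1, b)"] show ?case
    by (simp add: lattice_adj_def ac_simps)
qed

lemma route_imp_first_passage_time_le:
  assumes "route w u v x" "\<And>e. e \<in> lattice_edges \<Longrightarrow> 0 \<le> w e"
  shows "first_passage_time w u v \<le> x"
  using assms first_passage_time_le unfolding route_def by blast

subsection \<open>Concentration and anti-concentration of sums of weights\<close>

lemma countable_lattice_edges: "countable lattice_edges"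
proof -
  have "lattice_edges \<subseteq> range (\<lambda>(u, v). {u, v})"
    by (auto simp: lattice_edges_def)
  then show ?thesis by (rule countable_subset) simp
qed

context prob_space
begin

text \<open>Dominated convergence for indicators. It converts the almost sure statements in
  \<open>limit_shape\<close> into statements about the probability of one event at a time, which can
  then be contradicted by Markov's inequality or a union bound.\<close>

lemma AE_eventually_imp_prob_tendsto_1:
  assumes [measurable]: "\<And>n. Measurable.pred M (Q n)"
    and ae: "AE x in M. \<forall>\<^sub>F n in sequentially. Q n x"
  shows "(\<lambda>n. prob {x \<in> space M. Q n x}) \<longlonglongrightarrow> 1"
proof -
  have "(\<lambda>n. \<integral>x. indicator {x \<in> space M. Q n x} x \<partial>M) \<longlonglongrightarrow> (\<integral>x. (1::real) \<partial>M)"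
  proof (rule integral_dominated_convergence[where w = "\<lambda>_. 1"])
    show "AE x in M. (\<lambda>n. indicator {x \<in> space M. Q n x} x :: real) \<longlonglongrightarrow> 1"
      using ae AE_space
    proof eventually_elim
      case (elim x)
      have "\<forall>\<^sub>F n in sequentially. (1::real) = indicator {x \<in> space M. Q n x} x"
        using elim(1) by eventually_elim (use elim(2) in auto)
      then show ?case by (rule Lim_transform_eventually[OF tendsto_const])
    qed
  qed (auto simp: indicator_def)
  then show ?thesis by (simp add: prob_space)
qed

lemma integrable_power_of_bounded:
  fixes X :: "'a \<Rightarrow> real"
  assumes "random_variable borel X" "AE x in M. \<bar>X x\<bar> \<le> c"
  shows "integrable M (\<lambda>x. X x ^ k)"
proof (rule integrable_const_bound[where B = "c ^ k"])
  show "AE x in M. norm (X x ^ k) \<le> c ^ k"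
    using assms(2) by eventually_elim (simp add: power_abs power_mono)
qed (use assms(1) in simp)

lemma expectation_mult_power_indep:
  fixes X Y :: "'a \<Rightarrow> real"
  assumes "indep_var borel X borel Y" "AE x in M. \<bar>X x\<bar> \<le> a" "AE x in M. \<bar>Y x\<bar> \<le> b"
  shows "integrable M (\<lambda>x. X x ^ k * Y x ^ l)"
    and "expectation (\<lambda>x. X x ^ k * Y x ^ l) = expectation (\<lambda>x. X x ^ k) * expectation (\<lambda>x. Y x ^ l)"
proof -
  have "indep_var borel ((\<lambda>x. x ^ k) \<circ> X) borel ((\<lambda>x. x ^ l) \<circ> Y)"
    by (rule indep_var_compose[OF assms(1)]) auto
  then have indep: "indep_var borel (\<lambda>x. X x ^ k) borel (\<lambda>x. Y x ^ l)"
    by (simp add: comp_def)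
  have rv: "random_variable borel X" "random_variable borel Y"
    using indep_var_rv1[OF assms(1)] indep_var_rv2[OF assms(1)] by auto
  note int = integrable_power_of_bounded[OF rv(1) assms(2)] integrable_power_of_bounded[OF rv(2) assms(3)]
  show "integrable M (\<lambda>x. X x ^ k * Y x ^ l)"
    by (rule indep_var_integrable[OF indep int])
  show "expectation (\<lambda>x. X x ^ k * Y x ^ l) = expectation (\<lambda>x. X x ^ k) * expectation (\<lambda>x. Y x ^ l)"
    by (rule indep_var_lebesgue_integral[OF indep int])
qed

lemma AE_abs_sum_le:
  fixes V :: "'i \<Rightarrow> 'a \<Rightarrow> real"
  assumes "finite I" "\<And>i. i \<in> I \<Longrightarrow> AE x in M. \<bar>V i x\<bar> \<le> b"
  shows "AE x in M. \<bar>\<Sum>i\<in>I. V i x\<bar> \<le> real (card I) * b"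
proof -
  have "AE x in M. \<forall>i\<in>I. \<bar>V i x\<bar> \<le> b"
    using assms by (simp add: AE_finite_all)
  then show ?thesis
  proof eventually_elim
    case (elim x)
    have "\<bar>\<Sum>i\<in>I. V i x\<bar> \<le> (\<Sum>i\<in>I. \<bar>V i x\<bar>)" by (rule sum_abs)
    also have "\<dots> \<le> real (card I) * b" using elim by (intro sum_bounded_above) auto
    finally show ?case .
  qed
qed

text \<open>Induction adding one variable \<open>X\<close> to the sum \<open>Y\<close> of the
  earlier ones: by independence every cross term containing \<open>X\<close> or \<open>Y\<close> to
  the first power has mean zero, which leaves only the term in
  \<open>X\<^sup>2 * Y\<^sup>2\<close>.\<close>

lemma moments_indep_sum:
  fixes V :: "'i \<Rightarrow> 'a \<Rightarrow> real"
  assumes "finite I" and indep: "indep_vars (\<lambda>_. borel) V I"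
    and bound: "\<And>i. i \<in> I \<Longrightarrow> AE x in M. \<bar>V i x\<bar> \<le> b"
    and mean: "\<And>i. i \<in> I \<Longrightarrow> expectation (V i) = 0"
    and var: "\<And>i. i \<in> I \<Longrightarrow> expectation (\<lambda>x. V i x ^ 2) = v"
  shows "expectation (\<lambda>x. \<Sum>i\<in>I. V i x) = 0 \<and>
    expectation (\<lambda>x. (\<Sum>i\<in>I. V i x) ^ 2) = real (card I) * v \<and>
    expectation (\<lambda>x. (\<Sum>i\<in>I. V i x) ^ 4) \<le> 3 * real (card I) ^ 2 * b ^ 4"
  using assms
proof (induction I rule: finite_induct)
  case empty
  then show ?case by simp
next
  case (insert i I)
  define X where "X = V i"
  define Y where "Y = (\<lambda>x. \<Sum>i\<in>I. V i x)"
  define n where "n = real (card I)"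
  have "indep_vars (\<lambda>_. borel) V I"
    by (rule indep_vars_subset[OF insert.prems(1)]) auto
  then have IH: "expectation Y = 0" "expectation (\<lambda>x. Y x ^ 2) = n * v"
    "expectation (\<lambda>x. Y x ^ 4) \<le> 3 * n ^ 2 * b ^ 4"
    using insert by (simp_all add: Y_def n_def)
  have XY: "indep_var borel X borel Y"
    unfolding X_def Y_def by (rule indep_vars_sum[OF insert(1,2) insert.prems(1)])
  have bX: "AE x in M. \<bar>X x\<bar> \<le> b" unfolding X_def by (rule insert.prems(2)) simp
  have bY: "AE x in M. \<bar>Y x\<bar> \<le> n * b"
    unfolding Y_def n_def by (rule AE_abs_sum_le) (use insert in auto)
  have EX: "expectation X = 0" "expectation (\<lambda>x. X x ^ 2) = v"
    using insert.prems by (simp_all add: X_def)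
  have rv: "random_variable borel X" "random_variable borel Y"
    using indep_var_rv1[OF XY] indep_var_rv2[OF XY] by auto
  note intX = integrable_power_of_bounded[OF rv(1) bX]
  note intY = integrable_power_of_bounded[OF rv(2) bY]
  note intXY = expectation_mult_power_indep(1)[OF XY bX bY]
  note EXY = expectation_mult_power_indep(2)[OF XY bX bY]
  have X_le: "expectation (\<lambda>x. X x ^ (2 * k)) \<le> b ^ (2 * k)" for k
  proof -
    have "expectation (\<lambda>x. X x ^ (2 * k)) \<le> expectation (\<lambda>x. b ^ (2 * k))"
    proof (rule integral_mono_AE)
      show "AE x in M. X x ^ (2 * k) \<le> b ^ (2 * k)"
        using bX
      proof eventually_elim
        case (elim x)
        have "X x ^ (2 * k) = \<bar>X x\<bar> ^ (2 * k)" by (simp add: power_even_abs)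
        also have "\<dots> \<le> b ^ (2 * k)" using elim by (intro power_mono) auto
        finally show ?case .
      qed
    qed (use intX in auto)
    then show ?thesis by (simp add: prob_space)
  qed
  have v: "v \<le> b ^ 2" using X_le[of 1] EX by simp
  have "n \<ge> 0" by (simp add: n_def)
  have "expectation (\<lambda>x. (X x + Y x) ^ 2) =
      expectation (\<lambda>x. X x ^ 2 + 2 * (X x ^ 1 * Y x ^ 1) + Y x ^ 2)"
    by (intro Bochner_Integration.integral_cong) (auto simp: power2_eq_square algebra_simps)
  also have "\<dots> = expectation (\<lambda>x. X x ^ 2) + 2 * expectation (\<lambda>x. X x ^ 1 * Y x ^ 1) + expectation (\<lambda>x. Y x ^ 2)"
    using intX[of 2] intY[of 2] intXY[of 1 1]
    by (subst Bochner_Integration.integral_add Bochner_Integration.integral_mult_right_zero; simp)+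
  also have "\<dots> = (n + 1) * v"
    by (subst EXY) (simp add: EX IH algebra_simps)
  finally have E2: "expectation (\<lambda>x. (X x + Y x) ^ 2) = (n + 1) * v" .
  have "expectation (\<lambda>x. (X x + Y x) ^ 4) =
      expectation (\<lambda>x. X x ^ 4 + (4 * (X x ^ 3 * Y x ^ 1) + (6 * (X x ^ 2 * Y x ^ 2) +
        (4 * (X x ^ 1 * Y x ^ 3) + Y x ^ 4))))"
    by (intro Bochner_Integration.integral_cong) (auto simp: eval_nat_numeral algebra_simps)
  also have "\<dots> = expectation (\<lambda>x. X x ^ 4) + (4 * expectation (\<lambda>x. X x ^ 3 * Y x ^ 1) +
      (6 * expectation (\<lambda>x. X x ^ 2 * Y x ^ 2) +
        (4 * expectation (\<lambda>x. X x ^ 1 * Y x ^ 3) + expectation (\<lambda>x. Y x ^ 4))))"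
    using intX[of 4] intY[of 4] intXY[of 3 1] intXY[of 2 2] intXY[of 1 3]
    by (subst Bochner_Integration.integral_add Bochner_Integration.integral_mult_right_zero; simp)+
  also have "\<dots> = expectation (\<lambda>x. X x ^ 4) + 6 * (v * (n * v)) + expectation (\<lambda>x. Y x ^ 4)"
    by (subst EXY)+ (simp add: EX IH)
  also have "\<dots> \<le> b ^ 4 + 6 * (b ^ 2 * (n * b ^ 2)) + 3 * n ^ 2 * b ^ 4"
  proof -
    have "0 \<le> v" unfolding EX(2)[symmetric] by simp
    then have "v * (n * v) \<le> b ^ 2 * (n * b ^ 2)"
      using v \<open>n \<ge> 0\<close> by (intro mult_mono) auto
    then show ?thesis using X_le[of 2] IH(3) by simp
  qed
  \<comment> \<open>In units of \<open>b ^ 4\<close>, the sum 1 + 6 n + 3 n^2 falls short of 3 (n +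
    1)^2 by 2.\<close>
  also have "\<dots> \<le> 3 * (n + 1) ^ 2 * b ^ 4"
  proof -
    have "3 * (n + 1) ^ 2 * b ^ 4 - (b ^ 4 + 6 * (b ^ 2 * (n * b ^ 2)) + 3 * n ^ 2 * b ^ 4) = 2 * b ^ 4"
      by (simp add: power2_eq_square power4_eq_xxxx algebra_simps)
    moreover have "0 \<le> 2 * b ^ 4" by simp
    ultimately show ?thesis by linarith
  qed
  finally have E4: "expectation (\<lambda>x. (X x + Y x) ^ 4) \<le> 3 * (n + 1) ^ 2 * b ^ 4" .
  have E1: "expectation (\<lambda>x. X x + Y x) = 0"
    using intX[of 1] intY[of 1] EX IH by simp
  have "(\<Sum>j\<in>insert i I. V j x) = X x + Y x" for x
    using insert(1,2) by (simp add: X_def Y_def)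
  moreover have "real (card (insert i I)) = n + 1"
    using insert(1,2) by (simp add: n_def)
  ultimately show ?case using E1 E2 E4 by simp
qed

text \<open>Integrates the pointwise bound \<open>\<bar>S\<bar> / R \<ge> (S / R)\<^sup>2 - (S / R) ^ 4\<close>.\<close>

lemma expectation_abs_indep_sum_ge:
  fixes V :: "'i \<Rightarrow> 'a \<Rightarrow> real"
  assumes I: "finite I" and indep: "indep_vars (\<lambda>_. borel) V I"
    and bound: "\<And>i. i \<in> I \<Longrightarrow> AE x in M. \<bar>V i x\<bar> \<le> b"
    and mean: "\<And>i. i \<in> I \<Longrightarrow> expectation (V i) = 0"
    and var: "\<And>i. i \<in> I \<Longrightarrow> expectation (\<lambda>x. V i x ^ 2) = s ^ 2"
    and pos: "s > 0" "b > 0"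
  shows "s ^ 3 / (5 * b ^ 2) * sqrt (card I) \<le> expectation (\<lambda>x. \<bar>\<Sum>i\<in>I. V i x\<bar>)"
proof (cases "I = {}")
  case False
  define S where "S = (\<lambda>x. \<Sum>i\<in>I. V i x)"
  define q where "q = sqrt (real (card I))"
  have q: "q > 0" "real (card I) = q ^ 2"
    using I False by (auto simp: q_def card_gt_0_iff)
  \<comment> \<open>A scale of order \<open>b ^ 2 * q / s\<close> balances the second against the
    fourth moment. The factor 5/2 leaves 2/5 - 24/125 = 26/125 of \<open>s ^ 3 / b ^ 2 * q\<close>,
    just above the required fifth.\<close>
  define R where "R = 5 / 2 * b ^ 2 / s * q"
  have R: "R > 0" using pos q by (simp add: R_def)
  have mom: "expectation (\<lambda>x. S x ^ 2) = q ^ 2 * s ^ 2" "expectation (\<lambda>x. S x ^ 4) \<le> 3 * (q ^ 2) ^ 2 * b ^ 4"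
    using moments_indep_sum[OF I indep bound mean var] by (simp_all add: S_def q)
  have [measurable]: "random_variable borel S"
    unfolding S_def using indep by (intro borel_measurable_sum) (auto simp: indep_vars_def)
  have "AE x in M. \<bar>S x\<bar> \<le> real (card I) * b"
    unfolding S_def by (rule AE_abs_sum_le[OF I bound])
  note int = integrable_power_of_bounded[OF _ this]
  have ptw: "S x ^ 2 / R - S x ^ 4 / R ^ 3 \<le> \<bar>S x\<bar>" for x
  proof -
    define y where "y = \<bar>S x\<bar> / R"
    have y: "y \<ge> 0" using R by (simp add: y_def)
    \<comment> \<open>This is y \<ge> y^2 - y^4. For y at most 1 the term 1 - y is nonnegative;
      beyond 1 the cube dominates y.\<close>
    have "y * (1 - y + y ^ 3) \<ge> 0"
    proof (cases "y \<le> 1")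
      case True
      with y show ?thesis by simp
    next
      case False
      then have "y * 1 \<le> y * y ^ 2" using one_le_power[of y 2] by (intro mult_left_mono) auto
      then have "0 \<le> 1 - y + y ^ 3" by (simp add: power3_eq_cube power2_eq_square)
      with y show ?thesis by simp
    qed
    then have "R * (y ^ 2 - y ^ 4) \<le> R * y"
      using R by (intro mult_left_mono) (auto simp: eval_nat_numeral algebra_simps)
    moreover have "R * y = \<bar>S x\<bar>" "R * (y ^ 2 - y ^ 4) = S x ^ 2 / R - S x ^ 4 / R ^ 3"
      using R by (auto simp: y_def field_simps eval_nat_numeral)
    ultimately show ?thesis by simp
  qed
  have "s ^ 3 / (5 * b ^ 2) * q \<le> q ^ 2 * s ^ 2 / R - 3 * (q ^ 2) ^ 2 * b ^ 4 / R ^ 3"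
  proof -
    have "q ^ 2 * s ^ 2 / R - 3 * (q ^ 2) ^ 2 * b ^ 4 / R ^ 3 = 26 / 125 * (s ^ 3 / b ^ 2 * q)"
      using pos q(1) by (simp add: R_def field_simps eval_nat_numeral)
    moreover have "0 \<le> s ^ 3 / b ^ 2 * q" using pos q(1) by simp
    ultimately show ?thesis by simp
  qed
  also have "\<dots> \<le> expectation (\<lambda>x. S x ^ 2) / R - expectation (\<lambda>x. S x ^ 4) / R ^ 3"
    using mom R by (simp add: divide_right_mono)
  also have "\<dots> = expectation (\<lambda>x. S x ^ 2 / R - S x ^ 4 / R ^ 3)"
    using int[of 2] int[of 4] by simp
  also have "\<dots> \<le> expectation (\<lambda>x. \<bar>S x\<bar>)"
    using int[of 1] int[of 2] int[of 4] by (intro integral_mono ptw) auto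
  finally show ?thesis by (simp add: q_def S_def)
qed simp

end

section \<open>Independent weights in a narrow interval\<close>

text \<open>Abstracts the law of \<open>1 + \<epsilon> * X\<close>: a shift and scaling of X turns
  the standard deviation \<sigma> into \<open>\<epsilon> * \<sigma>\<close>, and \<tau> is the
  resulting mean.\<close>

locale perturbed_weights =
  fixes G :: "real measure" and \<epsilon> \<tau> \<sigma> :: real
  assumes prob_G: "prob_space G" and sets_G: "sets G = sets borel"
    and eps: "0 < \<epsilon>" and sigma: "0 < \<sigma>"
    and bounds: "AE x in G. x \<in> {1..1 + \<epsilon>}"
    and mean: "(\<integral>x. x \<partial>G) = \<tau>"
    and variance: "(\<integral>x. (x - \<tau>)\<^sup>2 \<partial>G) = (\<epsilon> * \<sigma>)\<^sup>2"
begin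

abbreviation P :: "((int \<times> int) set \<Rightarrow> real) measure" where
  "P \<equiv> Pi\<^sub>M lattice_edges (\<lambda>_. G)"

sublocale prob_space P
  by (rule prob_space_PiM) (rule prob_G)

lemma measurable_edge [measurable]: "e \<in> lattice_edges \<Longrightarrow> (\<lambda>w. w e) \<in> borel_measurable P"
  using measurable_component_singleton[of e lattice_edges "\<lambda>_. G"]
  by (simp add: measurable_cong_sets[OF refl sets_G])

lemma distr_edge: "e \<in> lattice_edges \<Longrightarrow> distr P borel (\<lambda>w. w e) = G"
  using distr_PiM_component[of lattice_edges "\<lambda>_. G" e] prob_G
  by (simp add: distr_cong[OF refl sets_G refl])

lemma expectation_edge:
  fixes f :: "real \<Rightarrow> real"
  assumes "e \<in> lattice_edges" "f \<in> borel_measurable borel"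
  shows "expectation (\<lambda>w. f (w e)) = (\<integral>x. f x \<partial>G)"
  using integral_distr[OF measurable_edge[OF assms(1)] assms(2)] distr_edge[OF assms(1)] by simp

lemma AE_edge: "e \<in> lattice_edges \<Longrightarrow> AE w in P. w e \<in> {1..1 + \<epsilon>}"
  by (rule AE_PiM_component[OF prob_G _ bounds])

lemma AE_edges: "AE w in P. \<forall>e\<in>lattice_edges. w e \<in> {1..1 + \<epsilon>}"
  using AE_edge by (simp add: AE_ball_countable[OF countable_lattice_edges])

text \<open>The joint law of the coordinates is the product measure itself, hence the product of
  their marginals, which characterises independence. The rewriting steps pass between the
  sigma-algebra of \<open>G\<close> and the Borel one.\<close>

lemma indep_edges:
  assumes "I \<subseteq> lattice_edges"
  shows "indep_vars (\<lambda>_. borel) (\<lambda>e w. w e) I"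
proof -
  have "{(0, 0), (1, 0)} \<in> lattice_edges"
    by (rule lattice_edgeI) (simp add: lattice_adj_def)
  then have ne: "lattice_edges \<noteq> {}" by blast
  have "distr P (Pi\<^sub>M lattice_edges (\<lambda>_. borel)) (\<lambda>x. \<lambda>i\<in>lattice_edges. x i) = distr P P (\<lambda>x. x)"
    by (rule distr_cong) (auto simp: sets_G space_PiM PiE_restrict intro!: sets_PiM_cong)
  also have "\<dots> = P" by simp
  also have "P = Pi\<^sub>M lattice_edges (\<lambda>e. distr P borel (\<lambda>w. w e))"
    by (intro PiM_cong refl) (simp add: distr_edge)
  finally have "indep_vars (\<lambda>_. borel) (\<lambda>e w. w e) lattice_edges"
    by (subst indep_vars_iff_distr_eq_PiM'[OF ne]) auto
  then show ?thesis by (rule indep_vars_subset) (rule assms)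
qed

lemma integrable_edge: "e \<in> lattice_edges \<Longrightarrow> integrable P (\<lambda>w. w e)"
proof (rule integrable_const_bound[where B = "1 + \<epsilon>"])
  assume "e \<in> lattice_edges"
  from AE_edge[OF this] show "AE w in P. norm (w e) \<le> 1 + \<epsilon>"
    by eventually_elim simp
qed simp

lemma expectation_edge_eq: "e \<in> lattice_edges \<Longrightarrow> expectation (\<lambda>w. w e) = \<tau>"
  using expectation_edge[of e "\<lambda>x. x"] mean by simp

lemma tau_bounds: "1 \<le> \<tau>" "\<tau> \<le> 1 + \<epsilon>"
proof -
  have e: "{(0, 0), (1, 0)} \<in> lattice_edges"
    by (rule lattice_edgeI) (simp add: lattice_adj_def)
  show "1 \<le> \<tau>"
    using integral_ge_const[OF integrable_edge[OF e], of 1] AE_edge[OF e] expectation_edge_eq[OF e]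
    by auto
  show "\<tau> \<le> 1 + \<epsilon>"
    using integral_le_const[OF integrable_edge[OF e], of "1 + \<epsilon>"] AE_edge[OF e] expectation_edge_eq[OF e]
    by auto
qed

text \<open>Hoeffding's exponent -2 D^2 / n is relaxed, by completing a square, to an expression
  linear in \<open>D\<close> that holds for every \<theta>. A single \<theta> can then serve paths
  of all lengths, with the logarithm of the number of paths absorbed into \<open>D\<close>.\<close>

lemma prob_sum_edges_le:
  fixes D \<theta> :: real
  assumes F: "finite F" "F \<subseteq> lattice_edges" and D: "0 \<le> D"
  shows "prob {w \<in> space P. (\<Sum>e\<in>F. w e) \<le> card F * \<tau> - \<epsilon> * D} \<le> exp (\<theta>\<^sup>2 * card F / 8 - \<theta> * D)"
proof (cases "F = {}")
  case True
  \<comment> \<open>Without edges the quotient in Hoeffding's exponent degenerates. The event is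
    then empty for positive \<open>D\<close>, and for \<open>D = 0\<close> the bound is 1.\<close>
  have *: "prob {w \<in> space P. (0::real) \<le> - (\<epsilon> * D)} \<le> exp (- \<theta> * D)"
  proof (cases "D = 0")
    case False
    with D eps have "\<not> (0::real) \<le> - (\<epsilon> * D)" by (simp add: not_le)
    then show ?thesis by simp
  qed simp
  with True show ?thesis by simp
next
  case False
  define n where "n = real (card F)"
  have n: "n > 0" using F False by (simp add: n_def card_gt_0_iff)
  interpret Hoeffding_ineq P F "\<lambda>e w. w e" "\<lambda>_. 1" "\<lambda>_. 1 + \<epsilon>" "\<Sum>e\<in>F. expectation (\<lambda>w. w e)"
    using F AE_edge indep_edges by unfold_locales auto
  have mu: "(\<Sum>e\<in>F. expectation (\<lambda>w. w e)) = n * \<tau>"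
    using F by (simp add: n_def expectation_edge_eq subset_iff)
  have "prob {w \<in> space P. (\<Sum>e\<in>F. w e) \<le> n * \<tau> - \<epsilon> * D} \<le> exp (- 2 * (\<epsilon> * D)\<^sup>2 / (n * \<epsilon>\<^sup>2))"
    using Hoeffding_ineq_le[of "\<epsilon> * D"] eps D n by (simp add: mu flip: n_def)
  also have "- 2 * (\<epsilon> * D)\<^sup>2 / (n * \<epsilon>\<^sup>2) \<le> \<theta>\<^sup>2 * n / 8 - \<theta> * D"
  proof -
    have "\<theta>\<^sup>2 * n / 8 - \<theta> * D + 2 * (\<epsilon> * D)\<^sup>2 / (n * \<epsilon>\<^sup>2) = (\<theta> * n / 2 - 2 * D)\<^sup>2 / (2 * n)"
      using n eps by (simp add: field_simps power2_eq_square)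
    moreover have "0 \<le> \<dots>" using n by simp
    ultimately show ?thesis by simp
  qed
  finally show ?thesis by (simp add: n_def)
qed

text \<open>The bound on absolute sums with s = \<epsilon> \<sigma> and b = \<epsilon>. The signs
  let it apply to the difference between the times of two disjoint routes.\<close>

lemma expectation_abs_signed_sum_ge:
  assumes F: "finite F" "F \<subseteq> lattice_edges" and g: "\<And>e. g e \<in> {-1, 1::real}"
  shows "\<epsilon> * \<sigma> ^ 3 / 5 * sqrt (card F) \<le> expectation (\<lambda>w. \<bar>\<Sum>e\<in>F. g e * (w e - \<tau>)\<bar>)"
proof -
  have "(\<epsilon> * \<sigma>) ^ 3 / (5 * \<epsilon> ^ 2) * sqrt (card F) \<le> expectation (\<lambda>w. \<bar>\<Sum>e\<in>F. g e * (w e - \<tau>)\<bar>)"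
  proof (rule expectation_abs_indep_sum_ge)
    show "indep_vars (\<lambda>_. borel) (\<lambda>e w. g e * (w e - \<tau>)) F"
      by (rule indep_vars_compose2[OF indep_edges[OF F(2)]]) auto
    fix e assume "e \<in> F"
    then have e: "e \<in> lattice_edges" using F by auto
    have g': "g e ^ 2 = 1" "\<bar>g e\<bar> = 1" using g[of e] by auto
    show "AE w in P. \<bar>g e * (w e - \<tau>)\<bar> \<le> \<epsilon>"
      using AE_edge[OF e] by eventually_elim (use tau_bounds in \<open>auto simp: abs_mult g'\<close>)
    show "expectation (\<lambda>w. g e * (w e - \<tau>)) = 0"
      using integrable_edge[OF e] expectation_edge_eq[OF e] by (simp add: prob_space)
    show "expectation (\<lambda>w. (g e * (w e - \<tau>))\<^sup>2) = (\<epsilon> * \<sigma>)\<^sup>2"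
      using expectation_edge[OF e, of "\<lambda>x. (x - \<tau>)\<^sup>2"] variance by (simp add: power_mult_distrib g')
  qed (use F eps sigma in auto)
  moreover have "(\<epsilon> * \<sigma>) ^ 3 / (5 * \<epsilon> ^ 2) = \<epsilon> * \<sigma> ^ 3 / 5"
    using eps by (simp add: field_simps eval_nat_numeral)
  ultimately show ?thesis by simp
qed

end

subsection \<open>Inner bound on the limit shape\<close>

text \<open>The route from \<open>(a, b)\<close> to \<open>(a + W, b + s)\<close> that walks along
  its row first and changes row at the end; s is 1 or -1 in use, and the names fit s = 1.\<close>

definition lower_edges :: "nat \<Rightarrow> int \<Rightarrow> int \<Rightarrow> int \<Rightarrow> (int \<times> int) set set" where
  "lower_edges W s a b = insert {(a + int W, b), (a + int W, b + s)}
     ((\<lambda>c. {(a + int c, b), (a + int c + 1, b)}) ` {..<W})"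

text \<open>The competing route between the same two corners, which changes row first.\<close>

definition upper_edges :: "nat \<Rightarrow> int \<Rightarrow> int \<Rightarrow> int \<Rightarrow> (int \<times> int) set set" where
  "upper_edges W s a b = insert {(a, b), (a, b + s)}
     ((\<lambda>c. {(a + int c, b + s), (a + int c + 1, b + s)}) ` {..<W})"

definition block_time :: "nat \<Rightarrow> int \<Rightarrow> int \<Rightarrow> int \<Rightarrow> ((int \<times> int) set \<Rightarrow> real) \<Rightarrow> real" where
  "block_time W s a b w = min (sum w (lower_edges W s a b)) (sum w (upper_edges W s a b))"

lemma finite_block_edges [simp]:
  "finite (lower_edges W s a b)" "finite (upper_edges W s a b)"
  by (simp_all add: lower_edges_def upper_edges_def)

lemma block_edges_subset:
  assumes "\<bar>s\<bar> = 1"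
  shows "lower_edges W s a b \<subseteq> lattice_edges" "upper_edges W s a b \<subseteq> lattice_edges"
  using assms by (auto simp: lower_edges_def upper_edges_def lattice_adj_def intro!: lattice_edgeI)

lemma inj_horizontal_edges: "inj_on (\<lambda>c. {(a + int c, b), (a + int c + 1, b)}) A"
  by (auto simp: inj_on_def doubleton_eq_iff)

lemma vertical_edge_notin_horizontal:
  assumes "s \<noteq> 0"
  shows "{(x, y), (x, y + s)} \<notin> (\<lambda>c. {(a + int c, b), (a + int c + 1, b)}) ` A"
  using assms by (auto simp: doubleton_eq_iff)

lemma sum_lower_edges:
  assumes "s \<noteq> 0"
  shows "sum w (lower_edges W s a b) =
    w {(a + int W, b), (a + int W, b + s)} + (\<Sum>c<W. w {(a + int c, b), (a + int c + 1, b)})"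
  unfolding lower_edges_def using vertical_edge_notin_horizontal[OF assms]
  by (subst sum.insert) (simp_all add: sum.reindex[OF inj_horizontal_edges])

lemma sum_upper_edges:
  assumes "s \<noteq> 0"
  shows "sum w (upper_edges W s a b) =
    w {(a, b), (a, b + s)} + (\<Sum>c<W. w {(a + int c, b + s), (a + int c + 1, b + s)})"
  unfolding upper_edges_def using vertical_edge_notin_horizontal[OF assms]
  by (subst sum.insert) (simp_all add: sum.reindex[OF inj_horizontal_edges])

lemma card_block_edges:
  assumes "s \<noteq> 0"
  shows "card (lower_edges W s a b) = Suc W" "card (upper_edges W s a b) = Suc W"
  unfolding lower_edges_def upper_edges_def using vertical_edge_notin_horizontal[OF assms]
  by (simp_all add: card_image[OF inj_horizontal_edges])

text \<open>For positive \<open>W\<close> the two vertical edges lie in different columns.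
  Disjointness makes the difference of the two route times a signed sum of independent centred
  weights.\<close>

lemma lower_upper_edges_disjoint:
  assumes "s \<noteq> 0" "W > 0"
  shows "lower_edges W s a b \<inter> upper_edges W s a b = {}"
  using assms by (auto simp: lower_edges_def upper_edges_def doubleton_eq_iff)

lemma route_block:
  assumes "route w u (a, b) x" "\<bar>s\<bar> = 1"
  shows "route w u (a + int W, b + s) (x + block_time W s a b w)"
proof -
  have s: "s \<noteq> 0" using assms(2) by auto
  have adj: "lattice_adj (y, b) (y, b + s)" for y using assms(2) by (simp add: lattice_adj_def)
  have "route w u (a + int W, b + s) (x + sum w (lower_edges W s a b))"
    using route_step[OF route_horizontal[OF assms(1)] adj] by (simp add: sum_lower_edges[OF s] add_ac)
  moreover have "route w u (a + int W, b + s) (x + sum w (upper_edges W s a b))"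
    using route_horizontal[OF route_step[OF assms(1) adj]] by (simp add: sum_upper_edges[OF s] add.assoc)
  ultimately show ?thesis by (simp add: block_time_def min_def)
qed

lemma route_blocks:
  assumes "\<bar>s\<bar> = 1"
  shows "route w (0, 0) (int j * int W, int j * s) (\<Sum>i<j. block_time W s (int i * int W) (int i * s) w)"
proof (induction j)
  case 0
  show ?case using route_refl by simp
next
  case (Suc j)
  from route_block[OF Suc assms, of W] show ?case by (simp add: algebra_simps)
qed

lemma mem_fpp_ball:
  assumes "first_passage_time w (0, 0) v \<le> t" "\<bar>x - of_int (fst v)\<bar> \<le> 1 / 2" "\<bar>y - of_int (snd v)\<bar> \<le> 1 / 2"
  shows "(x, y) \<in> fpp_ball w t"
proof -
  have "- (1 / 2) \<le> x - of_int (fst v)" "x - of_int (fst v) \<le> 1 / 2"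
    "- (1 / 2) \<le> y - of_int (snd v)" "y - of_int (snd v) \<le> 1 / 2"
    using assms(2,3) by linarith+
  note box = this
  have "(x, y) = map_prod real_of_int real_of_int v + (x - of_int (fst v), y - of_int (snd v))"
    by (cases v) simp
  also have "\<dots> \<in> fpp_ball w t"
    unfolding fpp_ball_def using assms(1) box by (intro set_plus_intro imageI) auto
  finally show ?thesis .
qed

text \<open>The unit box around a lattice point contains no other lattice point, so the box that
  covers \<open>(a, b)\<close> must be its own.\<close>

lemma fpp_ball_lattice_pointD:
  assumes "(of_int a, of_int b) \<in> fpp_ball w t"
  shows "first_passage_time w (0, 0) (a, b) \<le> t"
proof -
  obtain v d where v: "first_passage_time w (0, 0) v \<le> t" "d \<in> {- 1 / 2..1 / 2} \<times> {- 1 / 2..1 / 2}"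
    "(real_of_int a, real_of_int b) = map_prod of_int of_int v + d"
    using assms unfolding fpp_ball_def by (auto elim!: set_plus_elim)
  have "\<bar>real_of_int (a - fst v)\<bar> < 1" "\<bar>real_of_int (b - snd v)\<bar> < 1"
    using v(2,3) by (cases v; cases d; auto)+
  then have "v = (a, b)"
    by (cases v) (auto simp flip: of_int_abs of_int_diff)
  with v show ?thesis by simp
qed

context perturbed_weights
begin

lemma measurable_sum_edges [measurable]:
  "F \<subseteq> lattice_edges \<Longrightarrow> (\<lambda>w. sum w F) \<in> borel_measurable P"
  by (intro borel_measurable_sum measurable_edge) auto

lemma integrable_sum_edges: "F \<subseteq> lattice_edges \<Longrightarrow> integrable P (\<lambda>w. sum w F)"
  by (intro Bochner_Integration.integrable_sum integrable_edge) auto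

lemma expectation_sum_edges: "F \<subseteq> lattice_edges \<Longrightarrow> expectation (\<lambda>w. sum w F) = card F * \<tau>"
  using integrable_edge expectation_edge_eq by (subst Bochner_Integration.integral_sum) (auto simp: subset_iff)

lemma block_time_eq:
  "block_time W s a b w = (sum w (lower_edges W s a b) + sum w (upper_edges W s a b)
     - \<bar>sum w (lower_edges W s a b) - sum w (upper_edges W s a b)\<bar>) / 2"
  by (simp add: block_time_def min_def)

lemma integrable_block_time: "\<bar>s\<bar> = 1 \<Longrightarrow> integrable P (block_time W s a b)"
  unfolding block_time_eq[abs_def]
  by (intro Bochner_Integration.integrable_diff Bochner_Integration.integrable_add
      Bochner_Integration.integrable_divide integrable_abs integrable_sum_edges block_edges_subset)

text \<open>A minimum is the mean of the two values minus half their distance. Both routes have mean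
  \<open>(W + 1) * \<tau>\<close>, so the saving is half the expected absolute difference, a signed
  sum over 2 W + 2 independent weights.\<close>

lemma expectation_block_time_le:
  assumes s: "\<bar>s\<bar> = 1" and W: "W > 0"
  shows "expectation (block_time W s a b) \<le> (real W + 1) * \<tau> - \<epsilon> * \<sigma> ^ 3 / 10 * sqrt W"
proof -
  let ?L = "lower_edges W s a b" and ?U = "upper_edges W s a b"
  have s0: "s \<noteq> 0" using s by auto
  note sub = block_edges_subset[OF s, of W a b]
  have disj: "?L \<inter> ?U = {}" by (rule lower_upper_edges_disjoint[OF s0 W])
  have card: "card (?L \<union> ?U) = 2 * W + 2"
    by (subst card_Un_disjoint) (simp_all add: disj card_block_edges s0)
  define g :: "(int \<times> int) set \<Rightarrow> real" where "g e = (if e \<in> ?L then 1 else -1)" for e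
  have diff: "(\<Sum>e\<in>?L \<union> ?U. g e * (w e - \<tau>)) = sum w ?L - sum w ?U" for w
  proof -
    have "(\<Sum>e\<in>?L \<union> ?U. g e * (w e - \<tau>)) = (\<Sum>e\<in>?L. g e * (w e - \<tau>)) + (\<Sum>e\<in>?U. g e * (w e - \<tau>))"
      by (rule sum.union_disjoint) (simp_all add: disj)
    also have "(\<Sum>e\<in>?L. g e * (w e - \<tau>)) = (\<Sum>e\<in>?L. w e - \<tau>)"
      by (rule sum.cong) (auto simp: g_def)
    also have "(\<Sum>e\<in>?U. g e * (w e - \<tau>)) = (\<Sum>e\<in>?U. - (w e - \<tau>))"
      using disj by (intro sum.cong) (auto simp: g_def)
    finally show ?thesis
      by (simp add: sum_subtractf sum_negf card_block_edges[OF s0])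
  qed
  have "expectation (block_time W s a b) =
      (expectation (\<lambda>w. sum w ?L) + expectation (\<lambda>w. sum w ?U) - expectation (\<lambda>w. \<bar>sum w ?L - sum w ?U\<bar>)) / 2"
    unfolding block_time_eq[abs_def] using integrable_sum_edges[OF sub(1)] integrable_sum_edges[OF sub(2)]
    by simp
  also have "\<dots> = (real W + 1) * \<tau> - expectation (\<lambda>w. \<bar>sum w ?L - sum w ?U\<bar>) / 2"
    using sub by (simp add: expectation_sum_edges card_block_edges[OF s0] field_simps)
  also have "\<dots> \<le> (real W + 1) * \<tau> - (\<epsilon> * \<sigma> ^ 3 / 5 * sqrt (card (?L \<union> ?U))) / 2"
  proof -
    have "\<epsilon> * \<sigma> ^ 3 / 5 * sqrt (card (?L \<union> ?U)) \<le> expectation (\<lambda>w. \<bar>\<Sum>e\<in>?L \<union> ?U. g e * (w e - \<tau>)\<bar>)"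
      by (rule expectation_abs_signed_sum_ge) (use sub in \<open>auto simp: g_def\<close>)
    then show ?thesis unfolding diff by linarith
  qed
  \<comment> \<open>The square root of 2 W + 2 is simply bounded below by that of W.\<close>
  also have "\<dots> \<le> (real W + 1) * \<tau> - \<epsilon> * \<sigma> ^ 3 / 10 * sqrt W"
    using eps sigma by (simp add: card)
  finally show ?thesis .
qed

lemma AE_block_time_ge:
  assumes "\<bar>s\<bar> = 1"
  shows "AE w in P. real W + 1 \<le> block_time W s a b w"
  using AE_edges
proof eventually_elim
  case (elim w)
  have "real (card F) \<le> sum w F" if "F \<subseteq> lattice_edges" for F
    using sum_mono[of F "\<lambda>_. 1" w] elim that by auto
  from this[OF block_edges_subset(1)[OF assms, of W a b]] this[OF block_edges_subset(2)[OF assms, of W a b]]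
  show ?case using assms by (simp add: block_time_def card_block_edges)
qed

text \<open>If the functional \<open>a\<close> exceeded the bound \<open>h\<close> at
  \<open>u\<close>, then \<open>u / h'\<close>, with \<open>h'\<close> strictly between, would lie
  outside a slight enlargement of \<open>B\<close>. Going corner to corner through \<open>j\<close>
  blocks would then almost surely take longer than \<open>j * W * h'\<close> for all large
  \<open>j\<close>. Its mean is at most \<open>j * W * h\<close>, so Markov's inequality already
  contradicts this.\<close>

lemma inner_limit_shape_le:
  assumes B: "limit_shape G B" and s: "\<bar>s\<bar> = 1" and W: "W > 0"
    and a: "\<And>x. x \<in> B \<Longrightarrow> a \<bullet> x \<le> 1"
  shows "a \<bullet> (1, of_int s / real W) \<le> (1 + 1 / real W) * \<tau> - \<epsilon> * \<sigma> ^ 3 / 10 / sqrt W"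
proof (rule ccontr)
  define u :: "real \<times> real" where "u = (1, of_int s / real W)"
  define h where "h = (1 + 1 / real W) * \<tau> - \<epsilon> * \<sigma> ^ 3 / 10 / sqrt W"
  have hW: "h * real W = (real W + 1) * \<tau> - \<epsilon> * \<sigma> ^ 3 / 10 * sqrt W"
    using W by (simp add: h_def field_simps flip: power2_eq_square)
  define bt where "bt i w = block_time W s (int i * int W) (int i * s) w" for i w
  have int_bt: "integrable P (bt i)" for i unfolding bt_def by (rule integrable_block_time[OF s])
  have E_bt: "expectation (bt i) \<le> h * real W" for i
    unfolding bt_def hW by (rule expectation_block_time_le[OF s W])
  have AE_bt: "AE w in P. real W + 1 \<le> bt i w" for i
    unfolding bt_def by (rule AE_block_time_ge[OF s])
  have "real W + 1 \<le> expectation (bt 0)"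
    by (rule integral_ge_const[OF int_bt AE_bt])
  with E_bt[of 0] have "0 < h * real W" by linarith
  with W have h: "0 < h" by (simp add: zero_less_mult_iff)
  assume "\<not> a \<bullet> (1, of_int s / real W) \<le> (1 + 1 / real W) * \<tau> - \<epsilon> * \<sigma> ^ 3 / 10 / sqrt W"
  then have "h < a \<bullet> u" by (simp add: h_def u_def)
  then obtain h' where h': "h < h'" "h' < a \<bullet> u" using dense by blast
  \<comment> \<open>Half the available gap keeps \<open>a \<bullet> z\<close> strictly above
    \<open>1 + \<delta>\<close> for the point \<open>z = u / h'\<close>; the cap 1/2 respects the
    range of errors in \<open>limit_shape\<close>.\<close>
  define \<delta> where "\<delta> = min (1 / 2) ((a \<bullet> u / h' - 1) / 2)"
  have "\<delta> \<le> (a \<bullet> u / h' - 1) / 2" unfolding \<delta>_def by (rule min.cobounded2)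
  moreover have "1 < a \<bullet> u / h'" using h h' by simp
  ultimately have \<delta>: "0 < \<delta>" "\<delta> < 1" "(1 + \<delta>) < a \<bullet> u / h'"
    by (auto simp: \<delta>_def)
  define z where "z = (1 / h') *\<^sub>R u"
  have z: "z \<notin> (\<lambda>x. (1 + \<delta>) *\<^sub>R x) ` B"
  proof
    assume "z \<in> (\<lambda>x. (1 + \<delta>) *\<^sub>R x) ` B"
    then obtain x where x: "x \<in> B" "z = (1 + \<delta>) *\<^sub>R x" by auto
    have "a \<bullet> z \<le> 1 + \<delta>" using a[OF x(1)] \<delta> by (simp add: x(2))
    with \<delta>(3) show False by (simp add: z_def)
  qed
  \<comment> \<open>At this time the corner \<open>(j * W, j * s)\<close> rescales exactly to
    \<open>z\<close>.\<close>
  define t where "t j = real j * real W * h'" for j :: nat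
  have t_top: "filterlim t at_top sequentially"
    unfolding t_def using W h h'
    by (intro filterlim_at_top_mult_tendsto_pos[OF tendsto_const] filterlim_real_sequentially) auto
  define Q where "Q j w \<longleftrightarrow> t j < (\<Sum>i<j. bt i w)" for j w
  have [measurable]: "bt i \<in> borel_measurable P" for i
    using int_bt by auto
  have meas: "Measurable.pred P (Q j)" for j
    unfolding Q_def by measurable
  have AE_Q: "AE w in P. \<forall>\<^sub>F j in sequentially. Q j w"
    using limit_shapeD[OF B \<delta>(1,2)] AE_edges
  proof eventually_elim
    case (elim w)
    have "\<forall>\<^sub>F j in sequentially. (\<lambda>x. x /\<^sub>R t j) ` fpp_ball w (t j) \<subseteq> (\<lambda>x. (1 + \<delta>) *\<^sub>R x) ` B"
      using filterlim_iff[THEN iffD1, OF t_top, rule_format, OF elim(1)] by eventually_elim blast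
    then show ?case
      using eventually_gt_at_top[of 0]
    proof eventually_elim
      case (elim j)
      show ?case
      proof (rule ccontr)
        assume "\<not> Q j w"
        then have le: "(\<Sum>i<j. bt i w) \<le> t j" by (simp add: Q_def)
        have nonneg: "0 \<le> w e" if "e \<in> lattice_edges" for e
          using \<open>\<forall>e\<in>lattice_edges. w e \<in> {1..1 + \<epsilon>}\<close>[rule_format, OF that] by auto
        have "first_passage_time w (0, 0) (int j * int W, int j * s) \<le> t j"
          using route_imp_first_passage_time_le[OF route_blocks[OF s] nonneg] le
          unfolding bt_def by (rule order_trans)
        then have "(real j * real W, real j * of_int s) \<in> fpp_ball w (t j)"
          by (rule mem_fpp_ball) auto
        then have "(real j * real W, real j * of_int s) /\<^sub>R t j \<in> (\<lambda>x. x /\<^sub>R t j) ` fpp_ball w (t j)"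
          by (rule imageI)
        also have "(real j * real W, real j * of_int s) /\<^sub>R t j = z"
          using W h h' elim(2) by (simp add: z_def u_def t_def field_simps)
        finally show False using elim(1) z by blast
      qed
    qed
  qed
  have "prob {w \<in> space P. Q j w} \<le> h / h'" if "j > 0" for j
  proof -
    have tpos: "0 < t j" using that W h h' by (simp add: t_def)
    have "prob {w \<in> space P. Q j w} \<le> prob {w \<in> space P. (\<Sum>i<j. bt i w) \<ge> t j}"
      using meas[of j] by (intro finite_measure_mono) (auto simp: Q_def)
    also have "\<dots> \<le> expectation (\<lambda>w. \<Sum>i<j. bt i w) / t j"
    proof (rule integral_Markov_inequality_measure[where A = "{}"])
      have "AE w in P. \<forall>i\<in>{..<j}. real W + 1 \<le> bt i w"
        using AE_bt by (simp add: AE_finite_all)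
      then show "AE w in P. 0 \<le> (\<Sum>i<j. bt i w)"
        by eventually_elim (auto intro!: sum_nonneg elim!: order_trans[rotated] dest!: bspec)
    qed (use int_bt tpos in auto)
    also have "expectation (\<lambda>w. \<Sum>i<j. bt i w) = (\<Sum>i<j. expectation (bt i))"
      using int_bt by (intro Bochner_Integration.integral_sum) auto
    also have "\<dots> \<le> real j * (h * real W)"
      using sum_mono[of "{..<j}" "\<lambda>i. expectation (bt i)" "\<lambda>_. h * real W"] E_bt by simp
    finally show ?thesis
      using tpos that W h h' by (simp add: t_def field_simps)
  qed
  then have "\<forall>\<^sub>F j in sequentially. prob {w \<in> space P. Q j w} \<le> h / h'"
    by (intro eventually_mono[OF eventually_gt_at_top[of 0]])
  from tendsto_upperbound[OF AE_eventually_imp_prob_tendsto_1[OF meas AE_Q] this]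
  have "1 \<le> h / h'" by simp
  with h h' show False by (simp add: field_simps)
qed

text \<open>Weights are at most 2, so the ball at time \<open>t\<close> reaches every lattice point
  of l1 norm up to \<open>t / 2\<close>. One realisation and one large time suffice, since
  \<open>B\<close> is deterministic.\<close>

lemma zero_in_interior_limit_shape:
  assumes B: "limit_shape G B" and "\<epsilon> \<le> 1"
  shows "0 \<in> interior B"
proof -
  have "AE w in P. (\<forall>\<^sub>F t in at_top.
      (\<lambda>x. x /\<^sub>R t) ` fpp_ball w t \<subseteq> (\<lambda>x. (1 + 1 / 2) *\<^sub>R x) ` B) \<and> (\<forall>e\<in>lattice_edges. w e \<in> {1..1 + \<epsilon>})"
    using limit_shapeD[OF B, of "1 / 2"] AE_edges by (auto elim!: eventually_elim2 eventually_mono)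
  then obtain w where w: "\<forall>\<^sub>F t in at_top. (\<lambda>x. x /\<^sub>R t) ` fpp_ball w t \<subseteq> (\<lambda>x. (1 + 1 / 2) *\<^sub>R x) ` B"
    and w_le: "\<And>e. e \<in> lattice_edges \<Longrightarrow> 0 \<le> w e \<and> w e \<le> 2"
  \<comment> \<open>A realisation exists because an almost sure event in a probability space cannot
    be empty.\<close>
  proof (rule_tac ccontr)
    assume *: "\<not> thesis" "AE w in P. (\<forall>\<^sub>F t in at_top.
      (\<lambda>x. x /\<^sub>R t) ` fpp_ball w t \<subseteq> (\<lambda>x. (1 + 1 / 2) *\<^sub>R x) ` B) \<and> (\<forall>e\<in>lattice_edges. w e \<in> {1..1 + \<epsilon>})"
    from *(2) have "AE w in P. False"
      by eventually_elim (use *(1) that assms(2) in fastforce)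
    then show False by simp
  qed
  obtain t :: real where t: "(\<lambda>x. x /\<^sub>R t) ` fpp_ball w t \<subseteq> (\<lambda>x. (1 + 1 / 2) *\<^sub>R x) ` B" "t \<ge> 4"
    using eventually_happens'[OF trivial_limit_at_top_linorder eventually_conj[OF w eventually_ge_at_top[of 4]]]
    by blast
  \<comment> \<open>Enlarging by 3/2 turns 1/12 into 1/8. Rounding to the lattice then gives l1 norm
    at most t/4 + 1, and the travel time t/2 + 2 is at most t once t is at least 4.\<close>
  have "ball 0 (1 / 12) \<subseteq> B"
  proof
    fix p :: "real \<times> real" assume "p \<in> ball 0 (1 / 12)"
    then have n: "norm p < 1 / 12" by simp
    obtain x y where p: "(3 / 2) *\<^sub>R p = (x, y)" by fastforce
    have "\<bar>x\<bar> \<le> norm (x, y)" "\<bar>y\<bar> \<le> norm (x, y)"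
      using norm_fst_le[of x y] norm_snd_le[of y x] by auto
    then have xy: "\<bar>x\<bar> \<le> 1 / 8" "\<bar>y\<bar> \<le> 1 / 8" using n by (auto simp flip: p)
    define v where "v = (round (t * x), round (t * y))"
    have v: "\<bar>t * x - of_int (fst v)\<bar> \<le> 1 / 2" "\<bar>t * y - of_int (snd v)\<bar> \<le> 1 / 2"
      using of_int_round_abs_le[of "t * x"] of_int_round_abs_le[of "t * y"]
      by (simp_all add: v_def abs_minus_commute)
    have "\<bar>t * x\<bar> \<le> t * (1 / 8)" "\<bar>t * y\<bar> \<le> t * (1 / 8)"
      using xy t(2) by (auto simp: abs_mult)
    then have v_le: "real_of_int (\<bar>fst v\<bar> + \<bar>snd v\<bar>) \<le> t / 4 + 1"
      using v unfolding of_int_add of_int_abs by linarith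
    obtain q where q: "lattice_path (0, 0) v q" "int (length q - 1) = \<bar>fst v\<bar> + \<bar>snd v\<bar>"
      using exists_lattice_path by blast
    have "first_passage_time w (0, 0) v \<le> path_time w q"
      by (rule first_passage_time_le[OF q(1)]) (use w_le in auto)
    also have "\<dots> \<le> 2 * real (length q - 1)"
      by (rule path_time_le[OF q(1)]) (use w_le in auto)
    also have "real (length q - 1) = real_of_int (\<bar>fst v\<bar> + \<bar>snd v\<bar>)"
      unfolding q(2)[symmetric] by simp
    also have "2 * \<dots> \<le> t" using v_le t(2) by simp
    finally have "(t * x, t * y) \<in> fpp_ball w t" by (rule mem_fpp_ball) (fact v)+
    then have "(t * x, t * y) /\<^sub>R t \<in> (\<lambda>x. (1 + 1 / 2) *\<^sub>R x) ` B" using t(1) by blast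
    moreover have "(t * x, t * y) /\<^sub>R t = (3 / 2) *\<^sub>R p" using t(2) by (simp add: p)
    ultimately have "(3 / 2) *\<^sub>R p \<in> (\<lambda>x. (1 + 1 / 2) *\<^sub>R x) ` B" by (simp only:)
    then obtain b where "b \<in> B" "(3 / 2) *\<^sub>R p = (1 + 1 / 2) *\<^sub>R b" by (rule imageE)
    then show "p \<in> B" by simp
  qed
  then show ?thesis by (meson centre_in_ball interior_maximal open_ball subsetD zero_less_divide_1_iff zero_less_numeral)
qed

end

subsection \<open>Outer bound on the limit shape\<close>

context perturbed_weights
begin

text \<open>The admissible deviation at length \<open>l\<close> is affine in \<open>l\<close>, and its slope is small enough
  for the extra length of a longer path to outweigh it.\<close>

lemma deviation_bound:
  fixes W j :: nat and l :: nat
  assumes L: "1 \<le> L" "L \<le> real W" "ln (real W) \<le> 2 * L"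
    and small: "\<epsilon> * (4 + 9 * sqrt (L * real W)) \<le> 1"
    and l: "j * (W + 1) \<le> l"
  defines "\<theta> \<equiv> sqrt (L / real W)"
  shows "real j * real W * ((1 + 1 / real W) * \<tau> - 9 * \<epsilon> * sqrt (L / real W))
    \<le> real l * \<tau> - \<epsilon> * (\<theta> * real l / 8 + ((real l - real j * real W) * ln (real W) + 3 * real l / real W) / \<theta>)"
proof -
  define a b where "a = sqrt L" and "b = sqrt (real W)"
  have ab: "1 \<le> a" "a \<le> b" "1 \<le> b" "L = a ^ 2" "real W = b ^ 2"
    using L by (auto simp: a_def b_def)
  have \<theta>: "\<theta> = a / b" by (simp add: \<theta>_def a_def b_def real_sqrt_divide)
  have sq: "sqrt (L * real W) = a * b" by (simp add: a_def b_def real_sqrt_mult)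
  define c where "c = ln (real W) / \<theta>"
  have c: "c \<le> 2 * (a * b)"
  proof -
    have "c \<le> 2 * L / \<theta>"
      unfolding c_def using L(3) ab by (intro divide_right_mono) (auto simp: \<theta>)
    also have "\<dots> = 2 * (a * b)" using ab(1,3) by (simp add: \<theta> ab(4) power2_eq_square)
    finally show ?thesis .
  qed
  \<comment> \<open>The deviation equals \<open>l * d + (l - j * W) * c\<close>: every step costs
    \<open>d\<close>, and \<open>c\<close> accounts for the steps that are lost in the first
    coordinate.\<close>
  define d where "d = \<theta> / 8 + 3 / (real W * \<theta>)"
  have d_eq: "d = a / (8 * b) + 3 / (a * b)"
    using ab(1,3) by (simp add: d_def \<theta> ab(5) power2_eq_square mult.commute)
  have ab1: "1 \<le> a * b" using mult_mono[of 1 a 1 b] ab by simp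
  have d_le: "d \<le> 4"
  proof -
    have "a / (8 * b) \<le> 1" using ab by simp
    moreover have "3 / (a * b) \<le> 3" using ab1 by (simp add: divide_le_eq)
    ultimately show ?thesis by (simp add: d_eq)
  qed
  have d_nonneg: "0 \<le> d" using ab by (simp add: d_eq)
  have Wd: "(b ^ 2 + 1) * d \<le> 7 * (a * b)"
  proof -
    have "(b ^ 2 + 1) * d \<le> (2 * b ^ 2) * d"
      using ab d_nonneg by (intro mult_right_mono) auto
    also have "\<dots> = a * b / 4 + 6 * b / a"
      using ab(1,3) by (simp add: d_eq field_simps power2_eq_square)
    also have "6 * b / a \<le> 6 * (a * b)"
    proof -
      have "b * 1 \<le> b * (a * a)" using ab mult_mono[of 1 a 1 a] by (intro mult_left_mono) auto
      then show ?thesis using ab(1) by (simp add: divide_le_eq algebra_simps)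
    qed
    finally show ?thesis using ab1 by simp
  qed
  \<comment> \<open>The length beyond the minimum. Its coefficient
    \<open>\<tau> - \<epsilon> * (d + c)\<close> is nonnegative by the smallness of \<epsilon>, so
    only the minimal length matters. There \<open>(W + 1) * d + c\<close> is at most (7 + 2) a b,
    the source of the constant 9.\<close>
  define x where "x = real l - real j * (b ^ 2 + 1)"
  have "real (j * (W + 1)) \<le> real l" using l by (rule of_nat_mono)
  then have x: "0 \<le> x" by (simp add: x_def ab(5) algebra_simps)
  have "\<epsilon> * (d + c) \<le> \<epsilon> * (4 + 9 * (a * b))"
    using c d_le ab1 eps by (intro mult_left_mono) auto
  also have "\<dots> \<le> \<tau>" using small tau_bounds by (simp add: sq)
  finally have x_coeff: "0 \<le> x * (\<tau> - \<epsilon> * (d + c))" using x by simp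
  have main: "\<epsilon> * (real j * ((b ^ 2 + 1) * d + c)) \<le> \<epsilon> * (real j * (9 * (a * b)))"
    using Wd c eps by (intro mult_left_mono) auto
  have dev: "\<theta> * real l / 8 + ((real l - real j * real W) * ln (real W) + 3 * real l / real W) / \<theta>
    = real l * d + (real l - real j * b ^ 2) * c"
    by (simp add: d_def c_def ab(5) add_divide_distrib diff_divide_distrib algebra_simps)
  have l_eq: "real l = x + real j * (b ^ 2 + 1)" by (simp add: x_def)
  have "real j * real W * ((1 + 1 / real W) * \<tau> - 9 * \<epsilon> * sqrt (L / real W))
    = real j * (b ^ 2 + 1) * \<tau> - \<epsilon> * (real j * (9 * (a * b)))"
    using ab(1,3) by (simp add: ab(4,5) real_sqrt_divide field_simps power2_eq_square)
  also have "\<dots> \<le> real j * (b ^ 2 + 1) * \<tau> - \<epsilon> * (real j * ((b ^ 2 + 1) * d + c)) + x * (\<tau> - \<epsilon> * (d + c))"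
    using main x_coeff by linarith
  also have "\<dots> = real l * \<tau> - \<epsilon> * (real l * d + (real l - real j * b ^ 2) * c)"
    unfolding l_eq by (simp add: algebra_simps)
  finally show ?thesis unfolding dev .
qed

text \<open>If \<open>r * H > 1\<close>, the inclusion of a slightly shrunken \<open>B\<close>
  forces the passage time to \<open>(j * W, j * s)\<close> below \<open>j * W * H\<close> for large
  \<open>j\<close>. By the union bound, with probability tending to 1 no path is that fast.\<close>

lemma outer_limit_shape_le:
  assumes B: "limit_shape G B" and s: "\<bar>s\<bar> = 1" and r: "0 < r"
    and mem: "r *\<^sub>R (1, of_int s / real W) \<in> B"
    and L: "1 \<le> L" "L \<le> real W" "ln (real W) \<le> 2 * L"
    and small: "\<epsilon> * (4 + 9 * sqrt (L * real W)) \<le> 1"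
  shows "r * ((1 + 1 / real W) * \<tau> - 9 * \<epsilon> * sqrt (L / real W)) \<le> 1"
proof (rule ccontr)
  have W: "real W \<ge> 1" using L by linarith
  define H where "H = (1 + 1 / real W) * \<tau> - 9 * \<epsilon> * sqrt (L / real W)"
  define \<theta> where "\<theta> = sqrt (L / real W)"
  have \<theta>: "0 < \<theta>" using L W by (simp add: \<theta>_def)
  assume "\<not> r * ((1 + 1 / real W) * \<tau> - 9 * \<epsilon> * sqrt (L / real W)) \<le> 1"
  then have rH: "1 < r * H" by (simp add: H_def)
  then have "1 / (r * H) < 1" by simp
  \<comment> \<open>The shrinking factor \<open>q\<close> stays close enough to 1 that
    \<open>q * r * H\<close> still exceeds 1.\<close>
  then obtain q where q: "max 0 (1 / (r * H)) < q" "q < 1"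
    using dense[of "max 0 (1 / (r * H))" 1] by auto
  define \<rho> where "\<rho> = q * r"
  have \<rho>: "0 < \<rho>" "1 < \<rho> * H"
    using q r rH by (auto simp: \<rho>_def field_simps)
  define t where "t j = real j * real W / \<rho>" for j :: nat
  have t_top: "filterlim t at_top sequentially"
  proof -
    have "filterlim (\<lambda>j. real W / \<rho> * real j) at_top sequentially"
      by (rule filterlim_tendsto_pos_mult_at_top[OF tendsto_const _ filterlim_real_sequentially])
        (use W \<rho> in auto)
    then show ?thesis by (simp add: t_def[abs_def] mult.commute)
  qed
  define v where "v j = (int j * int W, int j * s)" for j
  \<comment> \<open>Chosen so that \<open>\<theta> * D\<close> cancels the Hoeffding term and the
    logarithm of the path count, which is at most \<open>(l - j * W) * ln W + 2 * l / W\<close>. One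
    further \<open>l / W\<close> remains as decay, at least \<open>j\<close>.\<close>
  define D where "D j l = \<theta> * real l / 8 + ((real l - real j * real W) * ln (real W) + 3 * real l / real W) / \<theta>"
    for j l :: nat
  \<comment> \<open>The lower end is the l1 distance to \<open>v j\<close>. Paths beyond the upper
    end are too slow deterministically, since every weight is at least 1, so the union bound runs
    over finitely many lengths.\<close>
  define lens where "lens j = {j * (W + 1)..4 * (j * (W + 1))}" for j
  define paths where "paths j l = {p \<in> paths_of_length (v j) l. distinct p}" for j l
  define Q where "Q j w \<longleftrightarrow> (\<exists>l\<in>lens j. \<exists>p\<in>paths j l. (\<Sum>e\<in>path_edges p. w e) \<le> real l * \<tau> - \<epsilon> * D j l)" for j w
  have path_len: "lattice_path (0, 0) (v j) p \<Longrightarrow> j * (W + 1) \<le> length p - 1" for j p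
    using length_lattice_path_ge[of "(0, 0)" "v j" p] s
    by (simp add: v_def abs_mult algebra_simps flip: of_nat_mult of_nat_add)
  have fin_paths: "finite (paths j l)" for j l
    using card_paths_of_length[of 1 "v j" l] by (simp add: paths_def)
  have paths_edges: "path_edges p \<subseteq> lattice_edges" "card (path_edges p) = l" if "p \<in> paths j l" for p j l
    using that path_edges_subset[of "(0, 0)" "v j" p] by (auto simp: paths_def paths_of_length_def card_path_edges)
  have meas_path: "{w \<in> space P. (\<Sum>e\<in>path_edges p. w e) \<le> c} \<in> events" if "p \<in> paths j l" for p j l c
    using measurable_sum_edges[OF paths_edges(1)[OF that]] by simp
  have Q_eq: "{w \<in> space P. Q j w} = (\<Union>l\<in>lens j. \<Union>p\<in>paths j l.
      {w \<in> space P. (\<Sum>e\<in>path_edges p. w e) \<le> real l * \<tau> - \<epsilon> * D j l})" for j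
    by (auto simp: Q_def)
  have meas: "Measurable.pred P (Q j)" for j
    unfolding pred_def Q_eq using fin_paths meas_path
    by (intro sets.finite_UN) (auto simp: lens_def)
  have prob_length: "prob (\<Union>p\<in>paths j l. {w \<in> space P. (\<Sum>e\<in>path_edges p. w e) \<le> real l * \<tau> - \<epsilon> * D j l})
    \<le> exp (- real j)" (is "prob (\<Union>p\<in>_. ?E p) \<le> _") if l: "l \<in> lens j" for j l
  proof -
    define x where "x = (real l - real j * real W) * ln (real W)"
    have "j * (W + 1) \<le> l" using l by (simp add: lens_def)
    then have "real (j * (W + 1)) \<le> real l" by (rule of_nat_mono)
    then have jl: "real j * (real W + 1) \<le> real l" by (simp add: algebra_simps)
    then have jl': "real j * real W \<le> real l" by (simp add: algebra_simps)
    have D: "0 \<le> D j l"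
      unfolding D_def using jl' W \<theta> by (intro add_nonneg_nonneg divide_nonneg_nonneg mult_nonneg_nonneg) auto
    have "prob (\<Union>p\<in>paths j l. ?E p) \<le> (\<Sum>p\<in>paths j l. prob (?E p))"
      using fin_paths meas_path by (intro finite_measure_subadditive_finite) auto
    also have "\<dots> \<le> (\<Sum>p\<in>paths j l. exp (\<theta>\<^sup>2 * real l / 8 - \<theta> * D j l))"
    proof (rule sum_mono)
      fix p assume p: "p \<in> paths j l"
      show "prob (?E p) \<le> exp (\<theta>\<^sup>2 * real l / 8 - \<theta> * D j l)"
        using prob_sum_edges_le[OF _ paths_edges(1)[OF p] D, where \<theta> = \<theta>] by (simp add: paths_edges(2)[OF p])
    qed
    also have "\<dots> = real (card (paths j l)) * exp (\<theta>\<^sup>2 * real l / 8 - \<theta> * D j l)" by simp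
    also have "\<dots> \<le> exp (2 * real l / real W + x) * exp (\<theta>\<^sup>2 * real l / 8 - \<theta> * D j l)"
    proof (rule mult_right_mono)
      have "card (paths j l) \<le> card (paths_of_length (v j) l)"
        using card_paths_of_length[of 1 "v j" l] by (intro card_mono) (auto simp: paths_def)
      \<comment> \<open>Taking z = 1/W matches the slope of the direction: the first factor is at
        most exp(2 l / W), while each unit lost in the first coordinate costs a factor W.\<close>
      then have "real (card (paths j l)) \<le> (1 + 1 / real W) ^ (2 * l) * (1 / real W) powr (of_int (fst (v j)) - real l)"
        using card_paths_of_length[of "1 / real W" "v j" l] W by simp
      also have "(1 / real W) powr (of_int (fst (v j)) - real l) = exp x"
        using W by (simp add: powr_def v_def x_def ln_div algebra_simps)
      also have "(1 + 1 / real W) ^ (2 * l) * exp x \<le> exp (1 / real W) ^ (2 * l) * exp x"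
        using W by (intro mult_right_mono power_mono exp_ge_add_one_self) auto
      also have "exp (1 / real W) ^ (2 * l) = exp (2 * real l / real W)"
        by (simp flip: exp_of_nat_mult)
      also have "\<dots> * exp x = exp (2 * real l / real W + x)" by (simp add: exp_add)
      finally show "real (card (paths j l)) \<le> exp (2 * real l / real W + x)" .
    qed simp
    also have "\<dots> = exp (- (real l / real W))"
    proof -
      have "\<theta> * D j l = \<theta>\<^sup>2 * real l / 8 + x + 3 * real l / real W"
        using \<theta> by (simp add: D_def x_def field_simps power2_eq_square)
      then show ?thesis by (simp add: add_divide_distrib flip: exp_add)
    qed
    also have "\<dots> \<le> exp (- real j)" using jl' W by (simp add: field_simps)
    finally show ?thesis .
  qed
  have prob_Q: "prob {w \<in> space P. Q j w} \<le> (3 * (real j * (real W + 1)) + 1) * exp (- real j)" for j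
  proof -
    have "prob {w \<in> space P. Q j w} \<le> (\<Sum>l\<in>lens j. prob (\<Union>p\<in>paths j l.
        {w \<in> space P. (\<Sum>e\<in>path_edges p. w e) \<le> real l * \<tau> - \<epsilon> * D j l}))"
      unfolding Q_eq using fin_paths meas_path
      by (intro finite_measure_subadditive_finite) (auto simp: lens_def intro!: sets.finite_UN)
    also have "\<dots> \<le> (\<Sum>l\<in>lens j. exp (- real j))"
      by (rule sum_mono) (rule prob_length)
    also have "\<dots> = (3 * (real j * (real W + 1)) + 1) * exp (- real j)"
      by (simp add: lens_def algebra_simps)
    finally show ?thesis .
  qed
  have q': "0 < 1 - q" "1 - q < 1" using q by auto
  have AE_Q: "AE w in P. \<forall>\<^sub>F j in sequentially. Q j w"
    using limit_shapeD[OF B q'] AE_edges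
  proof eventually_elim
    case (elim w)
    have "\<forall>\<^sub>F j in sequentially. (\<lambda>x. q *\<^sub>R x) ` B \<subseteq> (\<lambda>x. x /\<^sub>R t j) ` fpp_ball w (t j)"
      using filterlim_iff[THEN iffD1, OF t_top, rule_format, OF elim(1)] by eventually_elim auto
    then show ?case
      using eventually_gt_at_top[of 0]
    proof eventually_elim
      case (elim j)
      show ?case
      proof (rule ccontr)
        assume "\<not> Q j w"
        then have good: "real l * \<tau> - \<epsilon> * D j l < (\<Sum>e\<in>path_edges p. w e)" if "l \<in> lens j" "p \<in> paths j l" for l p
          using that by (auto simp: Q_def not_le)
        have w_ge: "1 \<le> w e" if "e \<in> lattice_edges" for e
          using \<open>\<forall>e\<in>lattice_edges. w e \<in> {1..1 + \<epsilon>}\<close>[rule_format, OF that] by auto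
        have path_ge: "real j * real W * H \<le> path_time w p" if p: "lattice_path (0, 0) (v j) p" for p
        proof -
          obtain p' where p': "lattice_path (0, 0) (v j) p'" "distinct p'" "path_time w p' \<le> path_time w p"
            using ex_distinct_lattice_path[OF p, of w] w_ge by force
          define l where "l = length p' - 1"
          have l: "j * (W + 1) \<le> l" using path_len[OF p'(1)] by (simp add: l_def)
          have "real j * real W * H \<le> path_time w p'"
          proof (cases "l \<in> lens j")
            case True
            have "p' \<in> paths j l"
              using p' by (auto simp: paths_def paths_of_length_def l_def lattice_path_def)
            from good[OF True this] have "real l * \<tau> - \<epsilon> * D j l < path_time w p'"
              by (simp add: path_time_eq_sum_path_edges[OF p'(2)])
            moreover have "real j * real W * H \<le> real l * \<tau> - \<epsilon> * D j l"
              unfolding H_def D_def \<theta>_def by (rule deviation_bound[OF L small l])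
            ultimately show ?thesis by simp
          next
            case False
            with l have "4 * (j * (W + 1)) \<le> l" by (simp add: lens_def)
            then have "real (4 * (j * (W + 1))) \<le> real l" by (rule of_nat_mono)
            also have "real l \<le> path_time w p'"
              using path_time_ge[OF p'(1), of 1 w] w_ge by (simp add: l_def)
            finally have "4 * (real j * (real W + 1)) \<le> path_time w p'" by (simp add: algebra_simps)
            moreover have "real j * real W * H \<le> 4 * (real j * (real W + 1))"
            proof -
              have "\<epsilon> * 4 \<le> \<epsilon> * (4 + 9 * sqrt (L * real W))"
                using eps L by (intro mult_left_mono) auto
              then have "\<tau> \<le> 2" using small tau_bounds by linarith
              have "real W * H \<le> real W * ((1 + 1 / real W) * \<tau>)"
                unfolding H_def using eps L W by (intro mult_left_mono) auto
              also have "\<dots> = (real W + 1) * \<tau>" using W by (simp add: field_simps)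
              also have "\<dots> \<le> (real W + 1) * 4" using \<open>\<tau> \<le> 2\<close> by (intro mult_left_mono) auto
              finally have "real j * (real W * H) \<le> real j * ((real W + 1) * 4)"
                by (intro mult_left_mono) auto
              then show ?thesis by (simp add: algebra_simps)
            qed
            ultimately show ?thesis by simp
          qed
          with p'(3) show ?thesis by simp
        qed
        have "real j * real W * H \<le> first_passage_time w (0, 0) (v j)"
          unfolding first_passage_time_def
          using exists_lattice_path[of "v j"] path_ge by (intro cINF_greatest) auto
        moreover have "t j < real j * real W * H"
        proof -
          have "0 < real j * real W" using elim(2) W by simp
          then have "real j * real W * 1 < real j * real W * (\<rho> * H)"
            using \<rho>(2) by (intro mult_strict_left_mono) auto
          then show ?thesis using \<rho>(1) by (simp add: t_def divide_less_eq algebra_simps)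
        qed
        ultimately have "t j < first_passage_time w (0, 0) (v j)" by simp
        moreover have "first_passage_time w (0, 0) (v j) \<le> t j"
        proof -
          have "q *\<^sub>R r *\<^sub>R (1, of_int s / real W) \<in> (\<lambda>x. q *\<^sub>R x) ` B"
            by (rule imageI) (rule mem)
          then obtain y where y: "y \<in> fpp_ball w (t j)" "q *\<^sub>R r *\<^sub>R (1, of_int s / real W) = y /\<^sub>R t j"
            using elim(1) by auto
          have tpos: "0 < t j" using elim(2) W \<rho> by (simp add: t_def)
          have "y = t j *\<^sub>R (y /\<^sub>R t j)" using tpos by simp
          also have "\<dots> = (t j * \<rho>) *\<^sub>R (1, of_int s / real W)"
            unfolding y(2)[symmetric] by (simp add: \<rho>_def)
          also have "\<dots> = (of_int (int j * int W), of_int (int j * s))"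
            using W \<rho> by (simp add: t_def)
          finally show ?thesis
            using y(1) unfolding v_def by (intro fpp_ball_lattice_pointD) simp
        qed
        ultimately show False by simp
      qed
    qed
  qed
  \<comment> \<open>The probability of \<open>Q j\<close> would tend to 0 by the union bound and to
    1 by the limit shape.\<close>
  have "(\<lambda>j. (3 * (real j * (real W + 1)) + 1) * exp (- real j)) \<longlonglongrightarrow> 0"
    by real_asymp
  from tendsto_le[OF _ this AE_eventually_imp_prob_tendsto_1[OF meas AE_Q]] prob_Q
  show False by simp
qed

end

subsection \<open>Counting edges\<close>

text \<open>Proper nonempty faces of a polyhedron are exposed. With the origin in the interior the
  supporting value is positive and can be scaled to 1.\<close>

lemma edge_supporting_functional:
  fixes B :: "(real \<times> real) set"
  assumes "polygon B" "0 \<in> interior B" "F edge_of B"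
  shows "\<exists>a. (\<forall>x\<in>B. a \<bullet> x \<le> 1) \<and> (\<forall>x\<in>F. a \<bullet> x = 1)"
proof -
  have poly: "polyhedron B" and dim: "aff_dim B = 2"
    using assms(1) by (auto simp: polygon_def polytope_imp_polyhedron)
  have F: "F face_of B" "aff_dim F = 1" using assms(3) by (auto simp: edge_of_def)
  then have "F exposed_face_of B" by (simp add: exposed_face_of_polyhedron[OF poly])
  moreover have "F \<noteq> {}" "F \<noteq> B" using F dim by auto
  ultimately obtain a b where ab: "a \<noteq> 0" "B \<subseteq> {x. a \<bullet> x \<le> b}" "F = B \<inter> {x. a \<bullet> x = b}"
    by (auto simp: exposed_face_of)
  obtain e where e: "0 < e" "cball 0 e \<subseteq> B"
    using assms(2) by (auto simp: mem_interior_cball)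
  have "(e / norm a) *\<^sub>R a \<in> B" using e ab(1) by (intro subsetD[OF e(2)]) simp
  then have "a \<bullet> ((e / norm a) *\<^sub>R a) \<le> b" using ab(2) by blast
  moreover have "0 < a \<bullet> ((e / norm a) *\<^sub>R a)" using e ab(1) by simp
  ultimately have b: "0 < b" by linarith
  show ?thesis
    by (rule exI[of _ "(1 / b) *\<^sub>R a"]) (use ab b in \<open>auto simp: divide_le_eq\<close>)
qed

text \<open>A ray from an interior point of a bounded set meets the boundary, which for a polygon is
  the union of its facets; in dimension 2 these are the edges.\<close>

lemma ray_meets_edge:
  fixes B :: "(real \<times> real) set"
  assumes "polygon B" "0 \<in> interior B" "u \<noteq> 0"
  shows "\<exists>F r. F edge_of B \<and> 0 < r \<and> r *\<^sub>R u \<in> F"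
proof -
  have poly: "polytope B" and dim: "aff_dim B = 2" using assms(1) by (auto simp: polygon_def)
  obtain r where r: "0 < r" "r *\<^sub>R u \<in> frontier B"
    using ray_to_frontier[OF polytope_imp_bounded[OF poly] assms(2,3)] by auto
  have "frontier B = rel_frontier B"
    using assms(2) by (intro rel_frontier_frontier[symmetric] affine_hull_nonempty_interior) auto
  also have "\<dots> = \<Union> {F. F facet_of B}"
    by (rule rel_frontier_of_polyhedron) (rule polytope_imp_polyhedron[OF poly])
  finally obtain F where "F facet_of B" "r *\<^sub>R u \<in> F" using r(2) by auto
  with r(1) dim show ?thesis by (auto simp: facet_of_def edge_of_def)
qed

text \<open>The point \<alpha> \<beta> is the geometric mean of \<alpha>^2 and \<beta>^2, and their
  convex combination with weights proportional to \<beta> and \<alpha>. Averaging the two bounds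
  gives 2 M \<alpha> \<beta> / (\<alpha> + \<beta>), below 2 M \<beta>.\<close>

lemma affine_interpolation_bound:
  fixes A B M \<alpha> \<beta> :: real
  assumes "0 < \<beta>" "\<beta> < \<alpha>" "0 \<le> M" "A + B * \<alpha>\<^sup>2 \<le> M * \<alpha>" "A + B * \<beta>\<^sup>2 \<le> M * \<beta>"
  shows "A + B * (\<alpha> * \<beta>) \<le> 2 * M * \<beta>"
proof -
  have "(\<alpha> + \<beta>) * (A + B * (\<alpha> * \<beta>)) = \<beta> * (A + B * \<alpha>\<^sup>2) + \<alpha> * (A + B * \<beta>\<^sup>2)"
    by (simp add: power2_eq_square algebra_simps)
  also have "\<dots> \<le> \<beta> * (M * \<alpha>) + \<alpha> * (M * \<beta>)"
    using assms by (intro add_mono mult_left_mono) auto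
  also have "\<dots> \<le> (\<alpha> + \<beta>) * (2 * M * \<beta>)"
    using assms by (simp add: algebra_simps)
  finally show ?thesis using assms by (simp add: mult_le_cancel_left)
qed

section \<open>Rays that cannot share an edge\<close>

context perturbed_weights
begin

text \<open>Each of the \<open>2 * M\<close> rays is assigned an edge that it meets, and the
  assignment is injective. The smallness of \<epsilon> separates rays of opposite sign, and the
  lower bound on \<open>k\<close> separates rays of the same sign. The bound on
  \<open>M * ln k\<close> ensures \<open>ln W \<le> 2 * L\<close> for
  \<open>W = k ^ (2 * i)\<close>.\<close>

lemma card_edges_limit_shape_ge:
  assumes B: "limit_shape G B" and poly: "polygon B"
    and "1 < k" and L: "1 \<le> L" "L \<le> (real k)\<^sup>2" "324 * L < (\<sigma> ^ 3 / 10)\<^sup>2 * real k"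
    and M: "real M * ln (real k) \<le> L" "\<epsilon> * (4 + 9 * (sqrt L * real k ^ M)) \<le> 1"
  shows "2 * M \<le> card {e. e edge_of B}"
proof -
  have k: "1 \<le> real k" using \<open>1 < k\<close> by simp
  have "\<epsilon> * 1 \<le> \<epsilon> * (4 + 9 * (sqrt L * real k ^ M))"
    using eps L(1) k by (intro mult_left_mono) auto
  then have "\<epsilon> \<le> 1" using M(2) by linarith
  then have int: "0 \<in> interior B" by (rule zero_in_interior_limit_shape[OF B])
  define m where "m = 9 * \<epsilon> * sqrt L"
  have m: "0 \<le> m" using eps L by (simp add: m_def)
  have mk: "m * real k ^ i < 1" if "i \<le> M" for i
  proof -
    have "m * real k ^ i \<le> m * real k ^ M"
      using m k that by (intro mult_left_mono power_increasing) auto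
    also have "\<dots> < \<epsilon> * (4 + 9 * (sqrt L * real k ^ M))"
      using eps by (simp add: m_def algebra_simps)
    finally show ?thesis using M(2) by simp
  qed
  define dir :: "int \<Rightarrow> nat \<Rightarrow> real \<times> real" where "dir s n = (1, of_int s / real n)" for s n
  define I where "I = {-1, 1 :: int} \<times> {1..M}"
  \<comment> \<open>With even exponents the intermediate block size \<open>k ^ (i + i')\<close> is
    the geometric mean of two such sizes and still a natural number, so the inner bound applies to
    it.\<close>
  define ray where "ray = (\<lambda>(s, i). dir s (k ^ (2 * i)))"
  have upper: "a \<bullet> dir s n \<le> (1 + 1 / real n) * \<tau> - \<epsilon> * \<sigma> ^ 3 / 10 / sqrt n"
    if "\<bar>s\<bar> = 1" "n > 0" "\<And>x. x \<in> B \<Longrightarrow> a \<bullet> x \<le> 1" for a s n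
    unfolding dir_def by (rule inner_limit_shape_le[OF B that])
  have lower: "(1 + 1 / real k ^ (2 * i)) * \<tau> - m / real k ^ i \<le> a \<bullet> ray (s, i)"
    if "(s, i) \<in> I" "r > 0" "r *\<^sub>R ray (s, i) \<in> B" "a \<bullet> (r *\<^sub>R ray (s, i)) = 1" for a r s i
  proof -
    have i: "1 \<le> i" "i \<le> M" and s: "\<bar>s\<bar> = 1" using that(1) by (auto simp: I_def)
    have sqrt_k: "sqrt (real (k ^ (2 * i))) = real k ^ i"
      by (simp add: power_mult mult.commute[of 2] flip: real_sqrt_power)
    have "r * ((1 + 1 / real (k ^ (2 * i))) * \<tau> - 9 * \<epsilon> * sqrt (L / real (k ^ (2 * i)))) \<le> 1"
    proof (rule outer_limit_shape_le[OF B s \<open>r > 0\<close> _ L(1)])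
      show "r *\<^sub>R (1, real_of_int s / real (k ^ (2 * i))) \<in> B" using that(3) by (simp add: ray_def dir_def)
      have "real k ^ 2 \<le> real k ^ (2 * i)" using k i by (intro power_increasing) auto
      then show "L \<le> real (k ^ (2 * i))" using L(2) by simp
      have "real i * ln (real k) \<le> real M * ln (real k)" using i k by (intro mult_right_mono) auto
      then show "ln (real (k ^ (2 * i))) \<le> 2 * L" using M(1) k by (simp add: ln_realpow)
      have "\<epsilon> * (4 + 9 * (sqrt L * real k ^ i)) \<le> \<epsilon> * (4 + 9 * (sqrt L * real k ^ M))"
        using eps L(1) k i by (intro mult_left_mono add_left_mono power_increasing) auto
      then show "\<epsilon> * (4 + 9 * sqrt (L * real (k ^ (2 * i)))) \<le> 1"
        using M(2) unfolding real_sqrt_mult sqrt_k by linarith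
    qed
    then have "r * ((1 + 1 / real k ^ (2 * i)) * \<tau> - m / real k ^ i) \<le> r * (a \<bullet> ray (s, i))"
      using that(4) unfolding real_sqrt_divide sqrt_k by (simp add: m_def)
    then show ?thesis using \<open>r > 0\<close> by simp
  qed
  have "\<exists>F r. F edge_of B \<and> 0 < r \<and> r *\<^sub>R ray p \<in> F" for p
    by (rule ray_meets_edge[OF poly int]) (simp add: ray_def dir_def zero_prod_def split: prod.split)
  then obtain F r where F: "\<And>p. F p edge_of B" "\<And>p. 0 < r p" "\<And>p. r p *\<^sub>R ray p \<in> F p"
    by metis
  have "\<exists>a. (\<forall>x\<in>B. a \<bullet> x \<le> 1) \<and> (\<forall>x\<in>F p. a \<bullet> x = 1)" for p
    by (rule edge_supporting_functional[OF poly int F(1)])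
  then obtain a where a: "\<And>p x. x \<in> B \<Longrightarrow> a p \<bullet> x \<le> 1" "\<And>p x. x \<in> F p \<Longrightarrow> a p \<bullet> x = 1"
    by metis
  have F_subset: "F p \<subseteq> B" for p using F(1) by (rule edge_of_imp_subset)
  have ray_bound: "(1 + 1 / real k ^ (2 * i)) * \<tau> - m / real k ^ i \<le> a p \<bullet> ray (s, i)"
    if "(s, i) \<in> I" "F (s, i) = F p" for s i p
  proof (rule lower[OF that(1) F(2)[of "(s, i)"]])
    show "r (s, i) *\<^sub>R ray (s, i) \<in> B" using F(3) F_subset by blast
    show "a p \<bullet> (r (s, i) *\<^sub>R ray (s, i)) = 1" using F(3)[of "(s, i)"] that(2) by (intro a(2)) simp
  qed
  have no_opposite: False if "(1, i) \<in> I" "(-1, i') \<in> I" "F (1, i) = F (-1, i')" for i i'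
  proof -
    obtain p q where pq: "a (1, i) = (p, q)" by fastforce
    \<comment> \<open>Averaging the inner bounds in the directions (1, 1/n) and (1, -1/n) eliminates
      \<open>q\<close>; n then tends to infinity.\<close>
    have "p \<le> \<tau>"
    proof (rule field_le_epsilon)
      fix e :: real assume "0 < e"
      obtain n :: nat where n: "\<tau> / e < real n" using reals_Archimedean2 by blast
      have n0: "n > 0" using n tau_bounds \<open>0 < e\<close> by (cases "n = 0") (auto simp: divide_less_0_iff)
      have pq_le: "(p, q) \<bullet> x \<le> 1" if "x \<in> B" for x using a(1)[OF that, of "(1, i)"] by (simp only: pq)
      have "(p, q) \<bullet> dir 1 n \<le> (1 + 1 / real n) * \<tau> - \<epsilon> * \<sigma> ^ 3 / 10 / sqrt n"
        "(p, q) \<bullet> dir (-1) n \<le> (1 + 1 / real n) * \<tau> - \<epsilon> * \<sigma> ^ 3 / 10 / sqrt n"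
        by (rule upper[OF _ n0 pq_le]; simp)+
      moreover have "0 \<le> \<epsilon> * \<sigma> ^ 3 / 10 / sqrt n" using eps sigma by simp
      ultimately have "p \<le> (1 + 1 / real n) * \<tau>" by (simp add: dir_def)
      also have "\<dots> = \<tau> + \<tau> / real n" by (simp add: algebra_simps)
      also have "\<tau> / real n \<le> e" using n n0 \<open>0 < e\<close> by (simp add: field_simps)
      finally show "p \<le> \<tau> + e" by simp
    qed
    \<comment> \<open>Multiplying by \<open>K\<^sup>2\<close> and cancelling leaves \<tau> \<le> t +
      m K with m K < 1. Applied to both \<open>q\<close> and \<open>- q\<close>, it makes both of
      them positive, as \<tau> is at least 1.\<close>
    have slope: "\<tau> - 1 < t" if "i \<le> M" "(1 + 1 / real k ^ (2 * i)) * \<tau> - m / real k ^ i \<le> p + t / real k ^ (2 * i)" for t i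
    proof -
      define K where "K = real k ^ i"
      have K: "1 \<le> K" "m * K < 1" using k mk[OF that(1)] by (auto simp: K_def)
      have "real k ^ (2 * i) = K ^ 2" by (simp add: K_def power_mult mult.commute[of 2])
      then have "(1 + 1 / K ^ 2) * \<tau> - m / K \<le> \<tau> + t / K ^ 2"
        using that(2) \<open>p \<le> \<tau>\<close> by (simp add: K_def)
      then have "K ^ 2 * ((1 + 1 / K ^ 2) * \<tau> - m / K) \<le> K ^ 2 * (\<tau> + t / K ^ 2)"
        by (intro mult_left_mono) auto
      moreover have "K ^ 2 * ((1 + 1 / K ^ 2) * \<tau> - m / K) = K ^ 2 * \<tau> + \<tau> - m * K"
        "K ^ 2 * (\<tau> + t / K ^ 2) = K ^ 2 * \<tau> + t"
        using K by (simp_all add: field_simps power2_eq_square)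
      ultimately have "\<tau> \<le> t + m * K" by linarith
      with K show ?thesis by simp
    qed
    have "\<tau> - 1 < q"
      using ray_bound[OF that(1) refl] that(1) by (intro slope[of i]) (auto simp: pq ray_def dir_def I_def)
    moreover have "\<tau> - 1 < - q"
      using ray_bound[of "-1" i' "(1, i)"] that by (intro slope[of i']) (auto simp: pq ray_def dir_def I_def)
    ultimately show False using tau_bounds by linarith
  qed
  have no_same: False if "(s, i) \<in> I" "(s, i') \<in> I" "i < i'" "F (s, i) = F (s, i')" for s i i'
  proof -
    have s: "\<bar>s\<bar> = 1" using that(1) by (auto simp: I_def)
    define c where "c = \<sigma> ^ 3 / 10"
    have c: "0 \<le> c" using sigma by (simp add: c_def)
    obtain p q where pq: "a (s, i) = (p, q)" by fastforce
    \<comment> \<open>The two slopes are \<alpha>^2 and \<beta>^2, and the saving at slope y is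
      \<open>(\<tau> - p) + (\<tau> - q * s) * y\<close>, affine in y because one functional serves
      both rays.\<close>
    define \<alpha> \<beta> where "\<alpha> = 1 / real k ^ i" and "\<beta> = 1 / real k ^ i'"
    have pos: "0 < \<beta>" "0 < \<alpha>" using k by (auto simp: \<alpha>_def \<beta>_def)
    have k\<beta>: "real k * \<beta> \<le> \<alpha>"
    proof -
      have "real k ^ Suc i \<le> real k ^ i'" using that(3) k by (intro power_increasing) auto
      then show ?thesis using k by (simp add: \<alpha>_def \<beta>_def field_simps)
    qed
    have "1 * \<beta> < real k * \<beta>" using \<open>k > 1\<close> pos by (intro mult_strict_right_mono) auto
    with k\<beta> have "\<beta> < \<alpha>" by simp
    have sq: "1 / real k ^ (2 * i) = \<alpha>\<^sup>2" "1 / real k ^ (2 * i') = \<beta>\<^sup>2"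
      by (simp_all add: \<alpha>_def \<beta>_def power_divide power_mult mult.commute[of 2])
    have dot: "a (s, i) \<bullet> ray (s, n) = p + q * of_int s * (1 / real k ^ (2 * n))" for n
      by (simp add: pq ray_def dir_def)
    have div: "m / real k ^ i = m * \<alpha>" "m / real k ^ i' = m * \<beta>" by (simp_all add: \<alpha>_def \<beta>_def)
    have "(\<tau> - p) + (\<tau> - q * of_int s) * \<alpha>\<^sup>2 \<le> m * \<alpha>"
      using ray_bound[OF that(1) refl] unfolding dot sq div by (simp add: algebra_simps)
    moreover have "(\<tau> - p) + (\<tau> - q * of_int s) * \<beta>\<^sup>2 \<le> m * \<beta>"
      using ray_bound[OF that(2) that(4)[symmetric]] unfolding dot sq div by (simp add: algebra_simps)
    ultimately have le: "(\<tau> - p) + (\<tau> - q * of_int s) * (\<alpha> * \<beta>) \<le> 2 * m * \<beta>"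
      by (intro affine_interpolation_bound pos \<open>\<beta> < \<alpha>\<close> m)
    have ab: "1 / real (k ^ (i + i')) = \<alpha> * \<beta>" by (simp add: \<alpha>_def \<beta>_def power_add)
    have "a (s, i) \<bullet> dir s (k ^ (i + i')) \<le> (1 + 1 / real (k ^ (i + i'))) * \<tau> - \<epsilon> * \<sigma> ^ 3 / 10 / sqrt (k ^ (i + i'))"
      using \<open>k > 1\<close> by (intro upper s a(1)) auto
    moreover have "\<epsilon> * \<sigma> ^ 3 / 10 / sqrt (k ^ (i + i')) = \<epsilon> * (\<sigma> ^ 3 / 10 * sqrt (\<alpha> * \<beta>))"
      by (simp add: real_sqrt_divide flip: ab)
    moreover have "a (s, i) \<bullet> dir s (k ^ (i + i')) = p + q * of_int s * (\<alpha> * \<beta>)"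
      by (simp add: pq dir_def flip: ab)
    ultimately have "\<epsilon> * (\<sigma> ^ 3 / 10 * sqrt (\<alpha> * \<beta>)) \<le> (\<tau> - p) + (\<tau> - q * of_int s) * (\<alpha> * \<beta>)"
      unfolding ab by (simp add: algebra_simps)
    with le have "\<epsilon> * (\<sigma> ^ 3 / 10 * sqrt (\<alpha> * \<beta>)) \<le> \<epsilon> * (18 * sqrt L * \<beta>)"
      by (simp add: m_def)
    then have "c * sqrt (\<alpha> * \<beta>) \<le> 18 * sqrt L * \<beta>" using eps by (simp add: c_def)
    \<comment> \<open>At the intermediate slope the saving is at least of order the root of \<alpha>
      \<beta>, but interpolation allows only order \<beta>. Squaring and using that \<alpha> is at
      least k \<beta> gives c^2 k \<le> 324 L, with 324 = 18^2 and 18 = 2 * 9.\<close>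
    then have "(c * sqrt (\<alpha> * \<beta>))\<^sup>2 \<le> (18 * sqrt L * \<beta>)\<^sup>2"
      using c pos by (intro power_mono) auto
    moreover have "(c * sqrt (\<alpha> * \<beta>))\<^sup>2 = \<beta> * (c\<^sup>2 * \<alpha>)"
      using pos by (simp add: power_mult_distrib)
    moreover have "(18 * sqrt L * \<beta>)\<^sup>2 = \<beta> * (324 * L * \<beta>)"
      using L(1) by (simp add: power_mult_distrib power2_eq_square[of \<beta>])
    ultimately have "c\<^sup>2 * \<alpha> \<le> 324 * L * \<beta>" using pos(1) by simp
    moreover have "c\<^sup>2 * (real k * \<beta>) \<le> c\<^sup>2 * \<alpha>"
      by (rule mult_left_mono[OF k\<beta>]) simp
    moreover have "324 * L * \<beta> < c\<^sup>2 * real k * \<beta>"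
      using L(3) pos(1) unfolding c_def by (rule mult_strict_right_mono)
    ultimately show False by (simp only: mult.assoc)
  qed
  have "inj_on F I"
  proof (rule inj_onI)
    fix x y assume xy: "x \<in> I" "y \<in> I" "F x = F y"
    obtain s i where x: "x = (s, i)" by fastforce
    obtain s' i' where y: "y = (s', i')" by fastforce
    have "s = s'"
    proof (rule ccontr)
      assume "s \<noteq> s'"
      then have "s = 1 \<and> s' = -1 \<or> s = -1 \<and> s' = 1" using xy x y by (auto simp: I_def)
      then show False using xy x y no_opposite by metis
    qed
    moreover have "i = i'"
    proof (rule ccontr)
      assume "i \<noteq> i'"
      then show False using xy x y \<open>s = s'\<close> no_same[of s i i'] no_same[of s i' i] by (metis linorder_neqE_nat)
    qed
    ultimately show "x = y" by (simp add: x y)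
  qed
  moreover have "F ` I \<subseteq> {e. e edge_of B}" using F(1) by auto
  moreover have "finite {e. e edge_of B}"
    by (rule finite_subset[OF _ finite_polytope_faces[of B]]) (use poly in \<open>auto simp: edge_of_def polygon_def\<close>)
  ultimately have "card I \<le> card {e. e edge_of B}" by (rule card_inj_on_le)
  then show ?thesis by (simp add: I_def)
qed

end

section \<open>Choice of parameters and conclusion\<close>

text \<open>Here \<open>exp (- L)\<close> plays the role of \<epsilon>. The factor 3/4 in
  \<open>M\<close> lies between two constraints: below 1, so that \<open>exp (- L) * k ^ M\<close>
  beats the factor \<open>sqrt L\<close>, and above 1/2, so that \<open>2 * M\<close> still exceeds
  \<open>L / ln L\<close> although \<open>ln k\<close> is \<open>ln L\<close> plus a bounded
  term.\<close>

lemma eventually_scale_parameters: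
  fixes c :: real
  assumes "0 < c"
  shows "\<forall>\<^sub>F L in at_top. \<exists>k M. 1 < k \<and> 1 \<le> L \<and> L \<le> (real k)\<^sup>2 \<and> 324 * L < c\<^sup>2 * real k \<and>
    real M * ln (real k) \<le> L \<and> exp (- L) * (4 + 9 * (sqrt L * real k ^ M)) \<le> 1 \<and>
    L / ln L \<le> 2 * real M"
proof -
  define C where "C = 324 / c\<^sup>2 + 2"
  have C: "C > 2" using assms by (simp add: C_def)
  have 1: "\<forall>\<^sub>F L::real in at_top. exp (- L) * (4 + 9 * (sqrt L * exp (3 / 4 * L))) \<le> 1"
    by real_asymp
  have 2: "\<forall>\<^sub>F L::real in at_top. L / ln L \<le> 2 * (3 / 4 * L / (ln C + ln L) - 1)"
    by real_asymp
  show ?thesis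
    using 1 2 eventually_ge_at_top[of 1]
  proof eventually_elim
    case (elim L)
    \<comment> \<open>The smallest integer above \<open>(C - 1) * L\<close>. As C - 1 = 324 / c^2 +
      1, it strictly exceeds both \<open>L\<close> and \<open>324 * L / c\<^sup>2\<close>, and it
      stays at most \<open>C * L\<close> because \<open>L \<ge> 1\<close>.\<close>
    define k where "k = nat \<lfloor>(C - 1) * L\<rfloor> + 1"
    define M where "M = nat \<lfloor>3 / 4 * L / ln (real k)\<rfloor>"
    have "0 \<le> (C - 1) * L" using C elim by simp
    then have k: "(C - 1) * L < real k" "real k \<le> (C - 1) * L + 1"
      unfolding k_def by linarith+
    have "1 * L \<le> (C - 1) * L" using C elim by (intro mult_right_mono) auto
    then have kL: "L < real k" using k by simp
    then have k1: "1 < real k" using elim by simp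
    have "324 / c\<^sup>2 * L \<le> (C - 1) * L" using elim by (intro mult_right_mono) (auto simp: C_def)
    then have "324 / c\<^sup>2 * L < real k" using k(1) by simp
    then have 324: "324 * L < c\<^sup>2 * real k" using assms by (simp add: field_simps)
    have "real k * 1 \<le> real k * real k" using k1 by (intro mult_left_mono) auto
    then have Lk: "L \<le> (real k)\<^sup>2" using kL by (simp add: power2_eq_square)
    have lnk: "0 < ln (real k)" using k1 by simp
    have "0 \<le> 3 / 4 * L / ln (real k)" using elim lnk by simp
    then have M: "real M \<le> 3 / 4 * L / ln (real k)" "3 / 4 * L / ln (real k) - 1 \<le> real M"
      unfolding M_def by linarith+
    have Mln: "real M * ln (real k) \<le> 3 / 4 * L" using M(1) lnk by (simp add: field_simps)
    have "real k ^ M = exp (real M * ln (real k))" using k1 by (simp add: exp_of_nat_mult)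
    also have "\<dots> \<le> exp (3 / 4 * L)" using Mln by simp
    finally have "exp (- L) * (4 + 9 * (sqrt L * real k ^ M)) \<le> exp (- L) * (4 + 9 * (sqrt L * exp (3 / 4 * L)))"
      using elim by (intro mult_left_mono add_left_mono) auto
    also have "\<dots> \<le> 1" by (rule elim)
    finally have small: "exp (- L) * (4 + 9 * (sqrt L * real k ^ M)) \<le> 1" .
    have "real k \<le> C * L" using k(2) elim by (simp add: algebra_simps)
    then have "ln (real k) \<le> ln (C * L)" using k1 by simp
    also have "\<dots> = ln C + ln L" using C elim by (simp add: ln_mult)
    finally have "ln (real k) \<le> ln C + ln L" .
    then have "3 / 4 * L / (ln C + ln L) \<le> 3 / 4 * L / ln (real k)"
      using lnk elim by (intro divide_left_mono mult_pos_pos) auto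
    then have "3 / 4 * L / (ln C + ln L) - 1 \<le> real M"
      by (rule order_trans[OF diff_right_mono M(2)])
    then have "2 * (3 / 4 * L / (ln C + ln L) - 1) \<le> 2 * real M" by (rule mult_left_mono) simp
    with elim have "L / ln L \<le> 2 * real M" by (meson order_trans)
    moreover have "1 < k" "real M * ln (real k) \<le> L" using k1 Mln elim by auto
    ultimately show ?case using Lk 324 small elim(3) by blast
  qed
qed

theorem theorem1p5:
  fixes \<sigma> :: real
  assumes "\<sigma> > 0"
  shows "\<exists>\<epsilon>\<^sub>0>0. \<forall>\<mu> :: real measure.
    real_distribution \<mu> \<longrightarrow> (AE x in \<mu>. x \<in> {0..1}) \<longrightarrow>
    prob_space.variance \<mu> (\<lambda>x. x) = \<sigma>\<^sup>2 \<longrightarrow>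
    (\<forall>\<epsilon>::real. 0 < \<epsilon> \<and> \<epsilon> < \<epsilon>\<^sub>0 \<longrightarrow>
      (\<forall>B. limit_shape (distr \<mu> borel (\<lambda>x. 1 + \<epsilon> * x)) B \<longrightarrow>
        ereal_of_enat (sides B) \<ge> ereal (ln (1 / \<epsilon>) / ln (ln (1 / \<epsilon>)))))"
proof -
  define c where "c = \<sigma> ^ 3 / 10"
  have "0 < c" using assms by (simp add: c_def)
  from eventually_scale_parameters[OF this] obtain N where
    N: "\<And>L. N \<le> L \<Longrightarrow> \<exists>k M. 1 < k \<and> 1 \<le> L \<and> L \<le> (real k)\<^sup>2 \<and> 324 * L < c\<^sup>2 * real k \<and>
    real M * ln (real k) \<le> L \<and> exp (- L) * (4 + 9 * (sqrt L * real k ^ M)) \<le> 1 \<and>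
    L / ln L \<le> 2 * real M"
    by (auto simp: eventually_at_top_linorder)
  \<comment> \<open>The threshold \<open>N\<close> was obtained from \<open>c\<close> alone, hence
    from \<sigma>, before any law is fixed. The witness \<open>exp (- N)\<close> for
    \<open>\<epsilon>\<^sub>0\<close> makes every admissible \<epsilon> satisfy
    \<open>N \<le> ln (1 / \<epsilon>)\<close>.\<close>
  show ?thesis
  proof (intro exI[of _ "exp (- N)"] conjI allI impI, simp)
    fix \<mu> :: "real measure" and \<epsilon> :: real and B :: "(real \<times> real) set"
    assume \<mu>: "real_distribution \<mu>" "AE x in \<mu>. x \<in> {0..1}" "prob_space.variance \<mu> (\<lambda>x. x) = \<sigma>\<^sup>2"
      and \<epsilon>: "0 < \<epsilon> \<and> \<epsilon> < exp (- N)"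
      and B: "limit_shape (distr \<mu> borel (\<lambda>x. 1 + \<epsilon> * x)) B"
    interpret real_distribution \<mu> by (rule \<mu>(1))
    define L where "L = ln (1 / \<epsilon>)"
    have \<epsilon>_eq: "\<epsilon> = exp (- L)" using \<epsilon> by (simp add: L_def ln_div)
    then have "N \<le> L" using \<epsilon> by simp
    from N[OF this] obtain k M where k: "1 < k" and kM: "1 \<le> L" "L \<le> (real k)\<^sup>2" "324 * L < c\<^sup>2 * real k"
      "real M * ln (real k) \<le> L" "\<epsilon> * (4 + 9 * (sqrt L * real k ^ M)) \<le> 1" "L / ln L \<le> 2 * real M"
      unfolding \<epsilon>_eq by blast
    define m where "m = expectation (\<lambda>x. x)"
    have int: "integrable \<mu> (\<lambda>x. x)"
      by (rule integrable_const_bound[where B = 1]) (use \<mu>(2) in auto)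
    have weights: "perturbed_weights (distr \<mu> borel (\<lambda>x. 1 + \<epsilon> * x)) \<epsilon> (1 + \<epsilon> * m) \<sigma>"
    proof (rule perturbed_weights.intro)
      show "prob_space (distr \<mu> borel (\<lambda>x. 1 + \<epsilon> * x))" by (rule prob_space_distr) simp
      show "AE x in distr \<mu> borel (\<lambda>x. 1 + \<epsilon> * x). x \<in> {1..1 + \<epsilon>}"
        using \<mu>(2) \<epsilon> by (subst AE_distr_iff) auto
      have "(\<integral>x. x \<partial>distr \<mu> borel (\<lambda>x. 1 + \<epsilon> * x)) = expectation (\<lambda>x. 1 + \<epsilon> * x)"
        by (rule integral_distr) simp_all
      also have "\<dots> = 1 + \<epsilon> * m" using int prob_space by (simp add: m_def)
      finally show "(\<integral>x. x \<partial>distr \<mu> borel (\<lambda>x. 1 + \<epsilon> * x)) = 1 + \<epsilon> * m" .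
      have "(\<integral>x. (x - (1 + \<epsilon> * m))\<^sup>2 \<partial>distr \<mu> borel (\<lambda>x. 1 + \<epsilon> * x)) = expectation (\<lambda>x. \<epsilon>\<^sup>2 * (x - m)\<^sup>2)"
      proof (subst integral_distr)
        have "(1 + \<epsilon> * x - (1 + \<epsilon> * m))\<^sup>2 = \<epsilon>\<^sup>2 * (x - m)\<^sup>2" for x
          by (simp flip: power_mult_distrib right_diff_distrib)
        then show "expectation (\<lambda>x. (1 + \<epsilon> * x - (1 + \<epsilon> * m))\<^sup>2) = expectation (\<lambda>x. \<epsilon>\<^sup>2 * (x - m)\<^sup>2)"
          by (simp only:)
      qed auto
      also have "\<dots> = (\<epsilon> * \<sigma>)\<^sup>2" using \<mu>(3) unfolding m_def[symmetric] by (simp add: power_mult_distrib)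
      finally show "(\<integral>x. (x - (1 + \<epsilon> * m))\<^sup>2 \<partial>distr \<mu> borel (\<lambda>x. 1 + \<epsilon> * x)) = (\<epsilon> * \<sigma>)\<^sup>2" .
    qed (use \<epsilon> assms in auto)
    have "ereal (L / ln L) \<le> ereal_of_enat (sides B)"
    \<comment> \<open>If \<open>B\<close> is not a polygon, \<open>sides B\<close> is infinite by
      definition and the bound is immediate.\<close>
    proof (cases "polygon B")
      case True
      have "2 * M \<le> card {e. e edge_of B}"
        by (rule perturbed_weights.card_edges_limit_shape_ge[OF weights B True k kM(1,2) _ kM(4,5)]) (use kM(3) in \<open>simp add: c_def\<close>)
      then have "L / ln L \<le> real (card {e. e edge_of B})" using kM(6) by linarith
      with True show ?thesis by (simp add: sides_def)
    qed (simp add: sides_def)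
    then show "ereal (ln (1 / \<epsilon>) / ln (ln (1 / \<epsilon>))) \<le> ereal_of_enat (sides B)"
      by (simp add: L_def)
  qed
qed

end
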